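(* If $g$ is an admissible free holomorphic function with universal model ${\bf W}=(W_1,\ldots,W_n)$, and $T=(T_1,\ldots,T_n)\in\overline{\mathcal D^{pure}_{g^{-1}}(\mathcal H)}$ (closure in the operator norm), then $$\Big\|\sum_{|\alpha|,|\beta|\le m}d_{\alpha,\beta}T_\alpha T_\beta^*\Big\|\le\Big\|\sum_{|\alpha|,|\beta|\le m}d_{\alpha,\beta}W_\alpha W_\beta^*\Big\|,\qquad m\in\mathbb N,\ d_{\alpha,\beta}\in\mathbb C.$$ Moreover, there is a unital completely contractive homomorphism $$\Psi_T:\mathcal A(g)\to B(\mathcal H),\qquad \Psi_T(p({\bf W})):=p(T),$$ for any polynomial $p$ in $n$ noncommutative indeterminates.
   Context: $\mathbb F_n^+$ is the unital free semigroup on generators $g_1,\ldots,g_n$ with identity $g_0$, and $|\alpha|$ is the length of $\alpha$. For $\alpha=g_{i_1}\cdots g_{i_k}$, $X_\alpha:=X_{i_1}\cdots X_{i_k}$, $X_{g_0}:=I$. $F^2(H_n)$ is the full Fock space with orthonormal basis $\{e_\alpha\}_{\alpha\in\mathbb F_n^+}$, where $e_\alpha=e_{i_1}\otimes\cdots\otimes e_{i_k}$, $e_{g_0}=1$, and $e_1,\ldots,e_n$ is an orthonormal basis of $H_n$. A formal power series $\sum_\alpha c_\alpha Z_\alpha$ in noncommuting indeterminates $Z_1,\ldots,Z_n$ is a free holomorphic function in a neighborhood of the origin if there is $\rho>0$ such that $\sum_{k=0}^\infty\sum_{|\alpha|=k}c_\alpha X_\alpha$ converges in norm for every Hilbert space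 $\mathcal H$ and every $X\in B(\mathcal H)^n$ with $\|X_1X_1^*+\cdots+X_nX_n^*\|^{1/2}\le\rho$; equivalently $\limsup_k(\sum_{|\alpha|=k}|c_\alpha|^2)^{1/2k}<\infty$. $g=1+\sum_{|\alpha|\ge1}b_\alpha Z_\alpha$ is admissible if: (a) $b_{g_0}=1$, all $b_\alpha>0$, and $\sup_\alpha b_\alpha/b_{g_i\alpha}<\infty$ for each $i$; (b) $g$ is free holomorphic in a neighborhood of the origin; (c) $\sup_{k}\big\|\sum_{p=0}^k\sum_{|\alpha|=p}a_\alpha W_\alpha W_\alpha^*\big\|<\infty$, where $g^{-1}=1+\sum_{|\alpha|\ge1}a_\alpha Z_\alpha$ is the inverse of $g$ as a power series ($a_{g_0}=1$) and $W_i\in B(F^2(H_n))$ are the weighted left creation operators $W_ie_\alpha=\sqrt{b_\alpha/b_{g_i\alpha}}\,e_{g_i\alpha}$. The tuple ${\bf W}=(W_1,\ldots,W_n)$ is the universal model associated with $g$. $\mathcal D_{g^{-1}}(\mathcal H)$ is the set of all $X\in B(\mathcal H)^n$ such that (i) $\Delta_{g^{-1}}(X,X^* ):=\sum_{p=0}^\infty\sum_{|\alpha|=p}a_\alpha X_\alpha X_\alpha^*$ converges in the weak operator topology and is $\ge0$; (ii) $\sum_{\alpha}b_\alpha X_\alpha\Delta_{g^{-1}}(X,X^* )X_\alpha^*\le I$, with convergence in the weak operator topology. $\mathcal D^{pure}_{g^{-1}}(\mathcal H)$ is the set of pure elements, i.e. those $X\in\mathcal D_{g^{-1}}(\mathcal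 H)$ with $\sum_\alpha b_\alpha X_\alpha\Delta_{g^{-1}}(X,X^* )X_\alpha^*=I$. The noncommutative domain algebra $\mathcal A(g)$ is the norm-closed non-self-adjoint algebra generated by $W_1,\ldots,W_n$ and the identity. *)

theory Defs
  imports "HOL-Analysis.Analysis" "HOL-Library.Poly_Mapping"
begin

section \<open>Complex Hilbert spaces\<close>

class scaleC =
  fixes scaleC :: "complex \<Rightarrow> 'a \<Rightarrow> 'a" (infixr \<open>*\<^sub>C\<close> 75)

class complex_vector = real_vector + scaleC +
  assumes scaleC_add_right: "c *\<^sub>C (x + y) = c *\<^sub>C x + c *\<^sub>C y"
    and scaleC_add_left: "(c + d) *\<^sub>C x = c *\<^sub>C x + d *\<^sub>C x"
    and scaleC_scaleC: "c *\<^sub>C d *\<^sub>C x = (c * d) *\<^sub>C x"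
    and scaleC_one: "1 *\<^sub>C x = x"
    and scaleR_scaleC: "r *\<^sub>R x = complex_of_real r *\<^sub>C x"

text \<open>The inner product is linear in the first argument. Its real part is the real inner
  product of the library, so that norm, topology and completeness are those of the library.\<close>

class chilbert_space = complex_vector + real_inner + complete_space +
  fixes cinner :: "'a \<Rightarrow> 'a \<Rightarrow> complex"
  assumes cinner_commute: "cinner x y = cnj (cinner y x)"
    and cinner_add_left: "cinner (x + y) z = cinner x z + cinner y z"
    and cinner_scaleC_left: "cinner (c *\<^sub>C x) y = c * cinner x y"
    and Re_cinner: "Re (cinner x y) = inner x y"

lemma norm_scaleC:
  fixes x :: "'a::chilbert_space"
  shows "norm (c *\<^sub>C x) = cmod c * norm x"
proof -
  have right: "cinner y (c *\<^sub>C z) = cnj c * cinner y z" for y z :: 'a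
    by (subst (1 2) cinner_commute) (simp add: cinner_scaleC_left)
  have "cinner (c *\<^sub>C x) (c *\<^sub>C x) = c * cnj c * cinner x x"
    by (simp add: cinner_scaleC_left right)
  then have "inner (c *\<^sub>C x) (c *\<^sub>C x) = Re (c * cnj c * cinner x x)"
    by (simp only: Re_cinner[symmetric])
  also have "c * cnj c = complex_of_real ((cmod c)\<^sup>2)"
    by (rule complex_norm_square[symmetric])
  also have "Re (complex_of_real ((cmod c)\<^sup>2) * cinner x x) = (cmod c)\<^sup>2 * inner x x"
    by (simp add: Re_cinner)
  finally show ?thesis
    by (simp add: norm_eq_sqrt_inner real_sqrt_mult)
qed

lemma bounded_linear_scaleC: "bounded_linear (\<lambda>x::'a::chilbert_space. c *\<^sub>C x)"
proof (rule bounded_linear_intro[where K = "cmod c"])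
  fix r and x :: 'a
  show "c *\<^sub>C r *\<^sub>R x = r *\<^sub>R c *\<^sub>C x"
    by (simp add: scaleR_scaleC scaleC_scaleC mult.commute)
qed (simp_all add: scaleC_add_right norm_scaleC mult.commute)

section \<open>Bounded operators\<close>

instantiation blinfun :: (real_normed_vector, chilbert_space) complex_vector
begin

lift_definition scaleC_blinfun :: "complex \<Rightarrow> ('a \<Rightarrow>\<^sub>L 'b) \<Rightarrow> ('a \<Rightarrow>\<^sub>L 'b)"
  is "\<lambda>c A x. c *\<^sub>C A x"
  by (rule bounded_linear_compose[OF bounded_linear_scaleC])

instance
  by (standard; transfer)
    (simp_all add: fun_eq_iff scaleC_add_right scaleC_add_left scaleC_scaleC scaleC_one scaleR_scaleC)

end

text \<open>The library type \<open>'a \<Rightarrow>\<^sub>L 'b\<close> consists of the real-linear bounded maps; the elements of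
  \<open>B(H)\<close> are those that are complex linear.\<close>

definition bounded_ops :: "('a::chilbert_space \<Rightarrow>\<^sub>L 'b::chilbert_space) set" where
  "bounded_ops = {A. \<forall>c x. blinfun_apply A (c *\<^sub>C x) = c *\<^sub>C blinfun_apply A x}"

definition adj :: "('a::chilbert_space \<Rightarrow>\<^sub>L 'b::chilbert_space) \<Rightarrow> ('b \<Rightarrow>\<^sub>L 'a)" where
  "adj A = (THE B. \<forall>x y. cinner (blinfun_apply A x) y = cinner x (blinfun_apply B y))"

definition positive_op :: "('a::chilbert_space \<Rightarrow>\<^sub>L 'a) \<Rightarrow> bool" where
  "positive_op A \<longleftrightarrow> A \<in> bounded_ops \<and>
     (\<forall>x. Im (cinner (blinfun_apply A x) x) = 0 \<and> 0 \<le> Re (cinner (blinfun_apply A x) x))"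

definition wot_tendsto ::
    "('t \<Rightarrow> ('a::chilbert_space \<Rightarrow>\<^sub>L 'a)) \<Rightarrow> ('a \<Rightarrow>\<^sub>L 'a) \<Rightarrow> 't filter \<Rightarrow> bool" where
  "wot_tendsto f A F \<longleftrightarrow> A \<in> bounded_ops \<and>
     (\<forall>x y. ((\<lambda>t. cinner (blinfun_apply (f t) x) y) \<longlongrightarrow> cinner (blinfun_apply A x) y) F)"

text \<open>The norm of a \<open>k \<times> k\<close> operator matrix, acting from the \<open>k\<close>-fold orthogonal sum of the
  domain to the \<open>k\<close>-fold orthogonal sum of the codomain.\<close>

definition op_matrix_norm ::
    "nat \<Rightarrow> (nat \<Rightarrow> nat \<Rightarrow> ('a::chilbert_space \<Rightarrow>\<^sub>L 'b::chilbert_space)) \<Rightarrow> real" where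
  "op_matrix_norm k M =
     Sup {L2_set (\<lambda>i. norm (\<Sum>j<k. blinfun_apply (M i j) (x j))) {..<k} | x.
            L2_set (\<lambda>j. norm (x j)) {..<k} \<le> 1}"

section \<open>The space of square summable families\<close>

typedef 'i ell2 = "{f :: 'i \<Rightarrow> complex. (\<lambda>i. (cmod (f i))\<^sup>2) summable_on UNIV}"
  morphisms ell2_coeff Abs_ell2
  by (rule exI[of _ "\<lambda>_. 0"]) simp

setup_lifting type_definition_ell2

lemma ell2_prod_abs_summable:
  assumes "(\<lambda>i. (cmod (f i))\<^sup>2) summable_on UNIV" "(\<lambda>i. (cmod (g i))\<^sup>2) summable_on UNIV"
  shows "(\<lambda>i. norm (f i * cnj (g i))) summable_on UNIV"
proof (rule Infinite_Sum.abs_summable_on_comparison_test')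
  show "(\<lambda>i. (cmod (f i))\<^sup>2 + (cmod (g i))\<^sup>2) summable_on UNIV"
    by (intro summable_on_add assms)
  fix i
  show "norm (f i * cnj (g i)) \<le> (cmod (f i))\<^sup>2 + (cmod (g i))\<^sup>2"
  proof -
    have "0 \<le> cmod (f i) * cmod (g i)"
      by simp
    then show ?thesis
      using sum_squares_bound[of "cmod (f i)" "cmod (g i)"] unfolding norm_mult complex_mod_cnj
      by linarith
  qed
qed

lemma ell2_prod_summable:
  assumes "(\<lambda>i. (cmod (f i))\<^sup>2) summable_on UNIV" "(\<lambda>i. (cmod (g i))\<^sup>2) summable_on UNIV"
  shows "(\<lambda>i. f i * cnj (g i)) summable_on UNIV"
  by (rule Infinite_Sum.abs_summable_summable[OF ell2_prod_abs_summable[OF assms]])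

lemma ell2_scale_summable:
  assumes "(\<lambda>i. (cmod (f i))\<^sup>2) summable_on UNIV"
  shows "(\<lambda>i. (cmod (c * f i))\<^sup>2) summable_on UNIV"
  using summable_on_cmult_right[OF assms, of "(cmod c)\<^sup>2"] by (simp add: norm_mult power_mult_distrib)

lemma ell2_add_summable:
  assumes "(\<lambda>i. (cmod (f i))\<^sup>2) summable_on UNIV" "(\<lambda>i. (cmod (g i))\<^sup>2) summable_on UNIV"
  shows "(\<lambda>i. (cmod (f i + g i))\<^sup>2) summable_on UNIV"
proof -
  have "(\<lambda>i. 2 * ((cmod (f i))\<^sup>2 + (cmod (g i))\<^sup>2)) summable_on UNIV"
    by (intro summable_on_cmult_right summable_on_add assms)
  then show ?thesis
  proof (rule summable_on_comparison_test)
    fix i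
    have "(cmod (f i + g i))\<^sup>2 \<le> (cmod (f i) + cmod (g i))\<^sup>2"
      by (intro power_mono norm_triangle_ineq) simp
    also have "\<dots> \<le> 2 * ((cmod (f i))\<^sup>2 + (cmod (g i))\<^sup>2)"
      using sum_squares_bound[of "cmod (f i)" "cmod (g i)"] by (simp add: power2_sum)
    finally show "(cmod (f i + g i))\<^sup>2 \<le> 2 * ((cmod (f i))\<^sup>2 + (cmod (g i))\<^sup>2)" .
  qed simp
qed

instantiation ell2 :: (type) complex_vector
begin

lift_definition zero_ell2 :: "'a ell2" is "\<lambda>_. 0" by simp
lift_definition plus_ell2 :: "'a ell2 \<Rightarrow> 'a ell2 \<Rightarrow> 'a ell2" is "\<lambda>f g i. f i + g i"
  by (rule ell2_add_summable)
lift_definition uminus_ell2 :: "'a ell2 \<Rightarrow> 'a ell2" is "\<lambda>f i. - f i" by simp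
lift_definition minus_ell2 :: "'a ell2 \<Rightarrow> 'a ell2 \<Rightarrow> 'a ell2" is "\<lambda>f g i. f i - g i"
  subgoal for f g using ell2_add_summable[of f "\<lambda>i. - g i"] by simp
  done
lift_definition scaleC_ell2 :: "complex \<Rightarrow> 'a ell2 \<Rightarrow> 'a ell2" is "\<lambda>c f i. c * f i"
  by (rule ell2_scale_summable)
lift_definition scaleR_ell2 :: "real \<Rightarrow> 'a ell2 \<Rightarrow> 'a ell2" is "\<lambda>r f i. complex_of_real r * f i"
  by (rule ell2_scale_summable)

instance
  by (standard; transfer) (simp_all add: fun_eq_iff algebra_simps)

end

definition ell2_cinner :: "'i ell2 \<Rightarrow> 'i ell2 \<Rightarrow> complex" where
  "ell2_cinner x y = (\<Sum>\<^sub>\<infinity>i. ell2_coeff x i * cnj (ell2_coeff y i))"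

lemma ell2_coeff_summable: "(\<lambda>i. (cmod (ell2_coeff x i))\<^sup>2) summable_on UNIV"
  using ell2_coeff[of x] by simp

lemma ell2_cinner_summable: "(\<lambda>i. ell2_coeff x i * cnj (ell2_coeff y i)) summable_on UNIV"
  by (intro ell2_prod_summable ell2_coeff_summable)

lemma ell2_cinner_commute: "ell2_cinner x y = cnj (ell2_cinner y x)"
  unfolding ell2_cinner_def by (simp add: infsum_cnj[symmetric] mult.commute del: infsum_cnj)

lemma ell2_cinner_add_left: "ell2_cinner (x + y) z = ell2_cinner x z + ell2_cinner y z"
  unfolding ell2_cinner_def
  by (simp add: plus_ell2.rep_eq distrib_right infsum_add ell2_cinner_summable)

lemma ell2_cinner_scaleC_left: "ell2_cinner (c *\<^sub>C x) y = c * ell2_cinner x y"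
  unfolding ell2_cinner_def
  by (simp add: scaleC_ell2.rep_eq mult.assoc infsum_cmult_right ell2_cinner_summable)

lemma Re_ell2_cinner_self: "Re (ell2_cinner x x) = (\<Sum>\<^sub>\<infinity>i. (cmod (ell2_coeff x i))\<^sup>2)"
  unfolding ell2_cinner_def
  by (subst infsum_Re[OF ell2_cinner_summable, symmetric])
    (simp add: complex_norm_square[symmetric] del: of_real_power times_complex.sel)

lemma ell2_eq_zero_iff: "Re (ell2_cinner x x) = 0 \<longleftrightarrow> x = 0"
proof
  assume *: "Re (ell2_cinner x x) = 0"
  have "(cmod (ell2_coeff x i))\<^sup>2 = 0" for i
    by (rule nonneg_infsum_le_0D[where A = UNIV])
      (use * in \<open>simp_all add: Re_ell2_cinner_self ell2_coeff_summable\<close>)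
  then show "x = 0"
    by (simp add: ell2_coeff_inject[symmetric] zero_ell2.rep_eq fun_eq_iff)
next
  assume "x = 0"
  then show "Re (ell2_cinner x x) = 0"
    by (simp add: ell2_cinner_def zero_ell2.rep_eq)
qed

instantiation ell2 :: (type) real_inner
begin

definition inner_ell2 :: "'a ell2 \<Rightarrow> 'a ell2 \<Rightarrow> real" where
  "inner_ell2 x y = Re (ell2_cinner x y)"
definition norm_ell2 :: "'a ell2 \<Rightarrow> real" where
  "norm_ell2 x = sqrt (inner x x)"
definition dist_ell2 :: "'a ell2 \<Rightarrow> 'a ell2 \<Rightarrow> real" where
  "dist_ell2 x y = norm (x - y)"
definition sgn_ell2 :: "'a ell2 \<Rightarrow> 'a ell2" where
  "sgn_ell2 x = inverse (norm x) *\<^sub>R x"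
definition uniformity_ell2 :: "('a ell2 \<times> 'a ell2) filter" where
  "uniformity_ell2 = (INF e\<in>{0<..}. principal {(x, y). dist x y < e})"
definition open_ell2 :: "'a ell2 set \<Rightarrow> bool" where
  "open_ell2 U \<longleftrightarrow> (\<forall>x\<in>U. \<forall>\<^sub>F (x', y) in uniformity. x' = x \<longrightarrow> y \<in> U)"

instance
proof
  fix x y z :: "'a ell2" and r :: real
  show "inner x y = inner y x"
    unfolding inner_ell2_def by (subst ell2_cinner_commute) simp
  show "inner (x + y) z = inner x z + inner y z"
    by (simp add: inner_ell2_def ell2_cinner_add_left)
  show "inner (r *\<^sub>R x) y = r * inner x y"
    by (simp add: inner_ell2_def scaleR_scaleC ell2_cinner_scaleC_left)
  show "0 \<le> inner x x"
    by (simp add: inner_ell2_def Re_ell2_cinner_self infsum_nonneg)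
  show "inner x x = 0 \<longleftrightarrow> x = 0"
    by (simp add: inner_ell2_def ell2_eq_zero_iff)
qed (simp_all add: norm_ell2_def dist_ell2_def sgn_ell2_def uniformity_ell2_def open_ell2_def)

end

lemma ell2_norm_square: "(norm (x :: 'i ell2))\<^sup>2 = (\<Sum>\<^sub>\<infinity>i. (cmod (ell2_coeff x i))\<^sup>2)"
  by (simp add: power2_norm_eq_inner inner_ell2_def Re_ell2_cinner_self)

lemma ell2_finite_sum_le:
  assumes "finite F"
  shows "(\<Sum>i\<in>F. (cmod (ell2_coeff x i))\<^sup>2) \<le> (norm x)\<^sup>2"
  unfolding ell2_norm_square
  by (rule finite_sum_le_infsum) (use assms in \<open>simp_all add: ell2_coeff_summable\<close>)

lemma ell2_coeff_le: "cmod (ell2_coeff x i) \<le> norm x"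
  by (rule power2_le_imp_le) (use ell2_finite_sum_le[of "{i}" x] in simp_all)

instance ell2 :: (type) complete_space
proof
  fix X :: "nat \<Rightarrow> 'a ell2"
  assume cau: "Cauchy X"
  have "Cauchy (\<lambda>n. ell2_coeff (X n) i)" for i
  proof (rule metric_CauchyI)
    fix e :: real assume "e > 0"
    then obtain N where "\<forall>m\<ge>N. \<forall>n\<ge>N. dist (X m) (X n) < e"
      using cau by (meson metric_CauchyD)
    moreover have "dist (ell2_coeff (X m) i) (ell2_coeff (X n) i) \<le> dist (X m) (X n)" for m n
      using ell2_coeff_le[of "X m - X n" i] by (simp add: dist_norm minus_ell2.rep_eq)
    ultimately show "\<exists>M. \<forall>m\<ge>M. \<forall>n\<ge>M. dist (ell2_coeff (X m) i) (ell2_coeff (X n) i) < e"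
      by (meson le_less_trans)
  qed
  then have "\<forall>i. \<exists>l. (\<lambda>n. ell2_coeff (X n) i) \<longlonglongrightarrow> l"
    by (simp add: Cauchy_convergent_iff convergent_def)
  then obtain f where f: "\<And>i. (\<lambda>n. ell2_coeff (X n) i) \<longlonglongrightarrow> f i"
    by metis
  have tail: "(\<Sum>i\<in>F. (cmod (ell2_coeff (X n) i - f i))\<^sup>2) \<le> e\<^sup>2"
    if "finite F" "\<forall>m\<ge>N. \<forall>n\<ge>N. dist (X m) (X n) < e" "n \<ge> N" for F N n e
  proof (rule tendsto_upperbound)
    show "((\<lambda>m. \<Sum>i\<in>F. (cmod (ell2_coeff (X n) i - ell2_coeff (X m) i))\<^sup>2)
            \<longlongrightarrow> (\<Sum>i\<in>F. (cmod (ell2_coeff (X n) i - f i))\<^sup>2)) sequentially"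
      by (intro tendsto_intros f)
    show "\<forall>\<^sub>F m in sequentially.
            (\<Sum>i\<in>F. (cmod (ell2_coeff (X n) i - ell2_coeff (X m) i))\<^sup>2) \<le> e\<^sup>2"
    proof (rule eventually_sequentiallyI[of N])
      fix m assume "m \<ge> N"
      have "(\<Sum>i\<in>F. (cmod (ell2_coeff (X n) i - ell2_coeff (X m) i))\<^sup>2) \<le> (norm (X n - X m))\<^sup>2"
        using ell2_finite_sum_le[OF that(1), of "X n - X m"] by (simp add: minus_ell2.rep_eq)
      also have "\<dots> \<le> e\<^sup>2"
        using that \<open>m \<ge> N\<close> by (intro power_mono) (auto simp: dist_norm less_imp_le)
      finally show "(\<Sum>i\<in>F. (cmod (ell2_coeff (X n) i - ell2_coeff (X m) i))\<^sup>2) \<le> e\<^sup>2" .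
    qed
  qed simp
  obtain N1 where N1: "\<forall>m\<ge>N1. \<forall>n\<ge>N1. dist (X m) (X n) < 1"
    using cau by (meson metric_CauchyD zero_less_one)
  have "(\<lambda>i. (cmod (ell2_coeff (X N1) i - f i))\<^sup>2) summable_on UNIV"
    proof (rule nonneg_bdd_above_summable_on)
    show "bdd_above (sum (\<lambda>i. (cmod (ell2_coeff (X N1) i - f i))\<^sup>2) ` {F. F \<subseteq> UNIV \<and> finite F})"
      by (rule bdd_aboveI2[where M = "1\<^sup>2"]) (use tail[OF _ N1 order_refl] in blast)
  qed simp
  from ell2_add_summable[OF ell2_coeff_summable[of "X N1"], of "\<lambda>i. - (ell2_coeff (X N1) i - f i)"] this
  have fsum: "(\<lambda>i. (cmod (f i))\<^sup>2) summable_on UNIV"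
    by (simp add: norm_minus_commute)
  define L where "L = Abs_ell2 f"
  have L: "ell2_coeff L = f"
    unfolding L_def by (rule Abs_ell2_inverse) (use fsum in simp)
  have "X \<longlonglongrightarrow> L"
  proof (rule metric_LIMSEQ_I)
    fix e :: real assume "e > 0"
    then obtain N where N: "\<forall>m\<ge>N. \<forall>n\<ge>N. dist (X m) (X n) < e / 2"
      using cau by (meson metric_CauchyD half_gt_zero)
    have "dist (X n) L < e" if "n \<ge> N" for n
    proof -
      have "(norm (X n - L))\<^sup>2 \<le> (e / 2)\<^sup>2"
        unfolding ell2_norm_square
        by (rule infsum_le_finite_sums[OF ell2_coeff_summable])
          (use tail[OF _ N that] in \<open>simp add: minus_ell2.rep_eq L\<close>)
      then have "norm (X n - L) \<le> e / 2"
        by (rule power2_le_imp_le) (use \<open>e > 0\<close> in simp)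
      then show ?thesis
        using \<open>e > 0\<close> by (simp add: dist_norm)
    qed
    then show "\<exists>N. \<forall>n\<ge>N. dist (X n) L < e"
      by blast
  qed
  then show "convergent X"
    by (rule convergentI)
qed

instantiation ell2 :: (type) chilbert_space
begin

definition cinner_ell2 :: "'a ell2 \<Rightarrow> 'a ell2 \<Rightarrow> complex" where
  "cinner_ell2 = ell2_cinner"

instance
proof
  fix x y z :: "'a ell2" and c :: complex
  show "cinner x y = cnj (cinner y x)"
    unfolding cinner_ell2_def by (rule ell2_cinner_commute)
  show "cinner (x + y) z = cinner x z + cinner y z"
    unfolding cinner_ell2_def by (rule ell2_cinner_add_left)
  show "cinner (c *\<^sub>C x) y = c * cinner x y"
    unfolding cinner_ell2_def by (rule ell2_cinner_scaleC_left)
  show "Re (cinner x y) = inner x y"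
    unfolding cinner_ell2_def inner_ell2_def by (rule refl)
qed

end

lift_definition ell2_basis :: "'i \<Rightarrow> 'i ell2" is "\<lambda>i j. if j = i then 1 else 0"
  subgoal for i
    by (rule finite_nonzero_values_imp_summable_on, rule finite_subset[of _ "{i}"]) auto
  done

section \<open>The free semigroup and power series in noncommuting indeterminates\<close>

text \<open>The generators are indexed by a nonempty finite type \<open>'n\<close>. The word
  \<open>g\<^bsub>i1\<^esub> \<dots> g\<^bsub>ik\<^esub>\<close> is the list \<open>[i1, \<dots>, ik]\<close>, the identity \<open>g\<^sub>0\<close> is \<open>[]\<close>, and \<open>g\<^sub>i \<alpha>\<close> is \<open>i # \<alpha>\<close>.
  A power series is its family of coefficients. The full Fock space is \<open>'n list ell2\<close>, with
  \<open>e\<^bsub>\<alpha>\<^esub>\<close> being \<open>ell2_basis \<alpha>\<close>.\<close>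

definition nps_one :: "'n list \<Rightarrow> real" where
  "nps_one \<alpha> = (if \<alpha> = [] then 1 else 0)"

definition nps_mult :: "('n list \<Rightarrow> real) \<Rightarrow> ('n list \<Rightarrow> real) \<Rightarrow> 'n list \<Rightarrow> real" where
  "nps_mult f g \<alpha> = (\<Sum>k\<le>length \<alpha>. f (take k \<alpha>) * g (drop k \<alpha>))"

definition nps_inverse :: "('n list \<Rightarrow> real) \<Rightarrow> 'n list \<Rightarrow> real" where
  "nps_inverse g = (THE h. nps_mult g h = nps_one \<and> nps_mult h g = nps_one)"

text \<open>Quantification over all Hilbert spaces is not available inside a formula; this is the
  equivalent Cauchy--Hadamard condition on the coefficients.\<close>

definition free_holomorphic_near_0 :: "('n::finite list \<Rightarrow> real) \<Rightarrow> bool" where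
  "free_holomorphic_near_0 c \<longleftrightarrow>
     limsup (\<lambda>k. ereal (root (2 * k) (\<Sum>\<alpha> | length \<alpha> = k. \<bar>c \<alpha>\<bar>\<^sup>2))) < \<infinity>"

fun word_op :: "('a::chilbert_space \<Rightarrow>\<^sub>L 'a) ^ 'n::finite \<Rightarrow> 'n list \<Rightarrow> ('a \<Rightarrow>\<^sub>L 'a)" where
  "word_op X [] = id_blinfun"
| "word_op X (i # \<alpha>) = (X $ i) o\<^sub>L word_op X \<alpha>"

definition poly_op ::
    "('n::finite list \<Rightarrow>\<^sub>0 complex) \<Rightarrow> ('a::chilbert_space \<Rightarrow>\<^sub>L 'a) ^ 'n \<Rightarrow> ('a \<Rightarrow>\<^sub>L 'a)" where
  "poly_op p X = (\<Sum>\<alpha>\<in>Poly_Mapping.keys p. Poly_Mapping.lookup p \<alpha> *\<^sub>C word_op X \<alpha>)"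

section \<open>The universal model and admissibility\<close>

definition weighted_creation ::
    "('n::finite list \<Rightarrow> real) \<Rightarrow> 'n \<Rightarrow> ('n list ell2 \<Rightarrow>\<^sub>L 'n list ell2)" where
  "weighted_creation b i = (THE A. A \<in> bounded_ops \<and>
     (\<forall>\<alpha>. blinfun_apply A (ell2_basis \<alpha>) = sqrt (b \<alpha> / b (i # \<alpha>)) *\<^sub>R ell2_basis (i # \<alpha>)))"

definition universal_model ::
    "('n::finite list \<Rightarrow> real) \<Rightarrow> ('n list ell2 \<Rightarrow>\<^sub>L 'n list ell2) ^ 'n" where
  "universal_model b = (\<chi> i. weighted_creation b i)"

definition defect_partial ::
    "('n::finite list \<Rightarrow> real) \<Rightarrow> ('a::chilbert_space \<Rightarrow>\<^sub>L 'a) ^ 'n \<Rightarrow> nat \<Rightarrow> ('a \<Rightarrow>\<^sub>L 'a)" where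
  "defect_partial b X k = (\<Sum>p\<le>k. \<Sum>\<alpha> | length \<alpha> = p.
     nps_inverse b \<alpha> *\<^sub>R (word_op X \<alpha> o\<^sub>L adj (word_op X \<alpha>)))"

definition admissible :: "('n::finite list \<Rightarrow> real) \<Rightarrow> bool" where
  "admissible b \<longleftrightarrow>
     b [] = 1 \<and> (\<forall>\<alpha>. 0 < b \<alpha>) \<and> (\<forall>i. bdd_above (range (\<lambda>\<alpha>. b \<alpha> / b (i # \<alpha>)))) \<and>
     free_holomorphic_near_0 b \<and>
     bdd_above (range (\<lambda>k. norm (defect_partial b (universal_model b) k)))"

section \<open>The noncommutative domain and its algebra\<close>

definition defect ::
    "('n::finite list \<Rightarrow> real) \<Rightarrow> ('a::chilbert_space \<Rightarrow>\<^sub>L 'a) ^ 'n \<Rightarrow> ('a \<Rightarrow>\<^sub>L 'a)" where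
  "defect b X = (THE D. wot_tendsto (defect_partial b X) D sequentially)"

text \<open>The second condition sums over words without an order, as the terms are positive.\<close>

definition defect_sum_is ::
    "('n::finite list \<Rightarrow> real) \<Rightarrow> ('a::chilbert_space \<Rightarrow>\<^sub>L 'a) ^ 'n \<Rightarrow> ('a \<Rightarrow>\<^sub>L 'a) \<Rightarrow> bool" where
  "defect_sum_is b X S \<longleftrightarrow>
     wot_tendsto
       (\<lambda>F. \<Sum>\<alpha>\<in>F. b \<alpha> *\<^sub>R (word_op X \<alpha> o\<^sub>L defect b X o\<^sub>L adj (word_op X \<alpha>)))
       S (finite_subsets_at_top UNIV)"

definition nc_domain :: "('n::finite list \<Rightarrow> real) \<Rightarrow> (('a::chilbert_space \<Rightarrow>\<^sub>L 'a) ^ 'n) set" where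
  "nc_domain b = {X. (\<forall>i. X $ i \<in> bounded_ops) \<and>
     (\<exists>D. wot_tendsto (defect_partial b X) D sequentially) \<and> positive_op (defect b X) \<and>
     (\<exists>S. defect_sum_is b X S \<and> positive_op (id_blinfun - S))}"

definition pure_nc_domain ::
    "('n::finite list \<Rightarrow> real) \<Rightarrow> (('a::chilbert_space \<Rightarrow>\<^sub>L 'a) ^ 'n) set" where
  "pure_nc_domain b = {X \<in> nc_domain b. defect_sum_is b X id_blinfun}"

definition closed_unital_subalgebra :: "('a::chilbert_space \<Rightarrow>\<^sub>L 'a) set \<Rightarrow> bool" where
  "closed_unital_subalgebra S \<longleftrightarrow> closed S \<and> id_blinfun \<in> S \<and>
     (\<forall>A\<in>S. \<forall>B\<in>S. A + B \<in> S \<and> A o\<^sub>L B \<in> S) \<and> (\<forall>c. \<forall>A\<in>S. c *\<^sub>C A \<in> S)"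

definition domain_algebra :: "('n::finite list \<Rightarrow> real) \<Rightarrow> ('n list ell2 \<Rightarrow>\<^sub>L 'n list ell2) set" where
  "domain_algebra b =
     \<Inter> {S. closed_unital_subalgebra S \<and> (\<forall>i. universal_model b $ i \<in> S)}"

definition unital_homomorphism_on ::
    "('a::chilbert_space \<Rightarrow>\<^sub>L 'a) set \<Rightarrow> (('a \<Rightarrow>\<^sub>L 'a) \<Rightarrow> ('b::chilbert_space \<Rightarrow>\<^sub>L 'b)) \<Rightarrow> bool" where
  "unital_homomorphism_on S \<Psi> \<longleftrightarrow> \<Psi> ` S \<subseteq> bounded_ops \<and> \<Psi> id_blinfun = id_blinfun \<and>
     (\<forall>A\<in>S. \<forall>B\<in>S. \<Psi> (A + B) = \<Psi> A + \<Psi> B \<and> \<Psi> (A o\<^sub>L B) = \<Psi> A o\<^sub>L \<Psi> B) \<and>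
     (\<forall>c. \<forall>A\<in>S. \<Psi> (c *\<^sub>C A) = c *\<^sub>C \<Psi> A)"

definition completely_contractive_on ::
    "('a::chilbert_space \<Rightarrow>\<^sub>L 'a) set \<Rightarrow> (('a \<Rightarrow>\<^sub>L 'a) \<Rightarrow> ('b::chilbert_space \<Rightarrow>\<^sub>L 'b)) \<Rightarrow> bool" where
  "completely_contractive_on S \<Psi> \<longleftrightarrow>
     (\<forall>k M. (\<forall>i<k. \<forall>j<k. M i j \<in> S) \<longrightarrow>
        op_matrix_norm k (\<lambda>i j. \<Psi> (M i j)) \<le> op_matrix_norm k M)"

end

theory Submission
  imports Defs
begin

text \<open>For pure \<open>T\<close> with defect operator \<open>\<Delta>\<close>, purity applied to \<open>T\<^sub>\<beta>\<^sup>* x\<close> and \<open>T\<^sub>\<alpha>\<^sup>* y\<close> reads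
  \<open>\<langle>T\<^sub>\<alpha> T\<^sub>\<beta>\<^sup>* x, y\<rangle> = \<Sum>\<^sub>\<gamma> b\<^sub>\<gamma> \<langle>\<Delta> T\<^bsub>\<beta>\<gamma>\<^esub>\<^sup>* x, T\<^bsub>\<alpha>\<gamma>\<^esub>\<^sup>* y\<rangle>\<close>, and \<open>W\<^sub>\<alpha> W\<^sub>\<beta>\<^sup>*\<close> sends \<open>e\<^bsub>\<beta>\<gamma>\<^esub>\<close> to a multiple of
  \<open>e\<^bsub>\<alpha>\<gamma>\<^esub>\<close> and kills the other basis vectors; this is the noncommutative Berezin transform. Truncating to
  finitely many words involves only finitely many vectors of \<open>H\<close>. The Gram matrix of these vectors
  for the form \<open>\<langle>\<Delta> \<sqdot>, \<sqdot>\<rangle>\<close> factorizes, so neither a square root of \<open>\<Delta>\<close> nor a Hilbert space tensor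
  product is needed, and the sum becomes a sum of values of the operator matrix in \<open>W\<close>. This bounds
  operator matrices in \<open>T\<close> by those in \<open>W\<close>; both sides are norm continuous in \<open>T\<close>, and the functional
  calculus is the continuous extension from the polynomials.\<close>

section \<open>Inner products and adjoints\<close>

text \<open>This makes the spaces of bounded maps complete, which is what turns Cauchy sequences of
  polynomials in \<open>T\<close> into operators later on.\<close>

instance chilbert_space \<subseteq> banach ..

lemma cinner_add_right: "cinner x (y + z) = cinner x y + cinner x (z::'a::chilbert_space)"
  by (subst (1 2 3) cinner_commute) (simp add: cinner_add_left)

lemma cinner_scaleC_right: "cinner x (c *\<^sub>C y) = cnj c * cinner x (y::'a::chilbert_space)"
  by (subst (1 2) cinner_commute) (simp add: cinner_scaleC_left)

lemma cinner_scaleR_left: "cinner (r *\<^sub>R x) y = of_real r * cinner x (y::'a::chilbert_space)"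
  by (simp add: scaleR_scaleC cinner_scaleC_left)

lemma cinner_scaleR_right: "cinner x (r *\<^sub>R y) = of_real r * cinner x (y::'a::chilbert_space)"
  by (simp add: scaleR_scaleC cinner_scaleC_right)

lemma cinner_zero_left [simp]: "cinner 0 (y::'a::chilbert_space) = 0"
  using cinner_add_left[of 0 0 y] by simp

lemma cinner_zero_right [simp]: "cinner (x::'a::chilbert_space) 0 = 0"
  using cinner_add_right[of x 0 0] by simp

lemma cinner_diff_left: "cinner (x - y) z = cinner x z - cinner y (z::'a::chilbert_space)"
  using cinner_add_left[of "x - y" y z] by simp

lemma cinner_diff_right: "cinner x (y - z) = cinner x y - cinner x (z::'a::chilbert_space)"
  using cinner_add_right[of x "y - z" z] by simp

lemma cinner_sum_left: "cinner (\<Sum>i\<in>S. f i) y = (\<Sum>i\<in>S. cinner (f i) (y::'a::chilbert_space))"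
  by (induction S rule: infinite_finite_induct) (simp_all add: cinner_add_left)

lemma cinner_sum_right: "cinner x (\<Sum>i\<in>S. f i) = (\<Sum>i\<in>S. cinner (x::'a::chilbert_space) (f i))"
  by (induction S rule: infinite_finite_induct) (simp_all add: cinner_add_right)

lemma cinner_self: "cinner x x = complex_of_real ((norm (x::'a::chilbert_space))\<^sup>2)"
proof (rule complex_eqI)
  have "Im (cinner x x) = - Im (cinner x x)"
    by (subst (1) cinner_commute) simp
  then show "Im (cinner x x) = Im (complex_of_real ((norm x)\<^sup>2))"
    by simp
qed (simp add: Re_cinner power2_norm_eq_inner)

text \<open>Rotating \<open>x\<close> by a unimodular scalar makes the inner product real and
  nonnegative, so the real Cauchy-Schwarz inequality applies.\<close>

lemma norm_cinner_le: "cmod (cinner x y) \<le> norm x * norm (y::'a::chilbert_space)"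
proof (cases "cinner x y = 0")
  case False
  let ?c = "cnj (sgn (cinner x y))"
  have "cnj z * z = complex_of_real ((cmod z)\<^sup>2)" for z
    by (subst mult.commute) (rule complex_norm_square[symmetric])
  then have "?c * cinner x y = complex_of_real (cmod (cinner x y))"
    using False by (simp add: sgn_div_norm scaleR_conv_of_real power2_eq_square mult.assoc)
  then have "cmod (cinner x y) = Re (cinner (?c *\<^sub>C x) y)"
    by (simp add: cinner_scaleC_left)
  also have "\<dots> \<le> norm (?c *\<^sub>C x) * norm y"
    unfolding Re_cinner by (rule norm_cauchy_schwarz)
  also have "\<dots> = norm x * norm y"
    using False by (simp add: norm_scaleC norm_sgn)
  finally show ?thesis .
qed simp

lemma cinner_eqI:
  fixes x y :: "'a::chilbert_space"
  assumes "\<And>z. cinner x z = cinner y z"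
  shows "x = y"
proof -
  have "cinner (x - y) (x - y) = 0"
    using assms by (simp add: cinner_diff_left)
  then show ?thesis by (simp add: cinner_self)
qed

text \<open>The representing vector is the minimizer of the quadratic functional
  \<open>\<phi>\<close>. The parallelogram law makes a minimizing sequence Cauchy, and stationarity
  of \<open>\<phi>\<close> at its limit along every line is the required identity.\<close>

lemma riesz_representation:
  fixes f :: "'a::{real_inner, complete_space} \<Rightarrow> real"
  assumes f: "bounded_linear f"
  shows "\<exists>y. \<forall>x. f x = inner x y"
proof -
  interpret f: bounded_linear f by (rule f)
  define \<phi> where "\<phi> x = (norm x)\<^sup>2 - 2 * f x" for x
  obtain K where K: "\<And>x. norm (f x) \<le> norm x * K"
    using f.bounded by blast
  have "- K\<^sup>2 \<le> \<phi> x" for x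
  proof -
    have "0 \<le> (norm x - K)\<^sup>2" by simp
    moreover have "f x \<le> norm x * K" using K[of x] by simp
    ultimately show ?thesis unfolding \<phi>_def power2_diff by simp
  qed
  then have bdd: "bdd_below (range \<phi>)" by (intro bdd_belowI2) simp
  define m where "m = Inf (range \<phi>)"
  have m: "m \<le> \<phi> x" for x
    unfolding m_def by (rule cInf_lower[OF _ bdd]) simp
  have "\<exists>x. \<phi> x < m + 1 / real (Suc n)" for n
    using cInf_lessD[of "range \<phi>" "m + 1 / real (Suc n)"] unfolding m_def by auto
  then obtain x where x: "\<And>n. \<phi> (x n) < m + 1 / real (Suc n)" by metis
  \<comment> \<open>The linear part of \<open>\<phi>\<close> cancels here, which leaves the
    parallelogram law. Since the midpoint value is at least \<open>m\<close>, the distance of two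
    near-minimizers is controlled by their excess over \<open>m\<close>.\<close>
  have par: "(norm (u - v))\<^sup>2 = 2 * \<phi> u + 2 * \<phi> v - 4 * \<phi> ((1/2) *\<^sub>R (u + v))" for u v
    unfolding \<phi>_def f.scaleR f.add power2_norm_eq_inner
    by (simp add: inner_simps inner_commute field_simps)
  have "Cauchy x"
  proof (rule metric_CauchyI)
    fix e :: real assume "e > 0"
    then obtain N where N: "1 / real (Suc N) < e\<^sup>2 / 4"
      using reals_Archimedean[of "e\<^sup>2 / 4"] by (auto simp: inverse_eq_divide)
    have "dist (x i) (x j) < e" if "i \<ge> N" "j \<ge> N" for i j
    proof -
      have "1 / real (Suc i) \<le> 1 / real (Suc N)" "1 / real (Suc j) \<le> 1 / real (Suc N)"
        using that by (simp_all add: frac_le)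
      then have "(norm (x i - x j))\<^sup>2 < e\<^sup>2"
        unfolding par using x[of i] x[of j] m[of "(1/2) *\<^sub>R (x i + x j)"] N by linarith
      then show ?thesis
        using \<open>e > 0\<close> by (simp add: dist_norm power_less_imp_less_base)
    qed
    then show "\<exists>M. \<forall>i\<ge>M. \<forall>j\<ge>M. dist (x i) (x j) < e" by blast
  qed
  then obtain z where z: "x \<longlonglongrightarrow> z"
    by (auto simp: Cauchy_convergent_iff convergent_def)
  have "\<phi> z \<le> m"
  proof (rule LIMSEQ_le)
    show "(\<lambda>n. \<phi> (x n)) \<longlonglongrightarrow> \<phi> z"
      unfolding \<phi>_def by (intro tendsto_intros z f.tendsto)
    show "(\<lambda>n. m + 1 / real (Suc n)) \<longlonglongrightarrow> m"
      using tendsto_add[OF tendsto_const LIMSEQ_inverse_real_of_nat, of m]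
      by (simp add: inverse_eq_divide)
    show "\<exists>N. \<forall>n\<ge>N. \<phi> (x n) \<le> m + 1 / real (Suc n)"
      using x by (auto intro: less_imp_le)
  qed
  have "f y = inner y z" for y
  proof (cases "y = 0")
    case False
    define s where "s = f y - inner y z"
    \<comment> \<open>This \<open>t\<close> minimizes the quadratic polynomial
      \<open>\<phi> (z + t *\<^sub>R y)\<close>. The decrease it achieves is
      \<open>s\<^sup>2 / (norm y)\<^sup>2\<close>, which must vanish at a minimizer
      \<open>z\<close>.\<close>
    define t where "t = s / (norm y)\<^sup>2"
    have "\<phi> z \<le> \<phi> (z + t *\<^sub>R y)"
      using \<open>\<phi> z \<le> m\<close> m order_trans by blast
    moreover have "\<phi> (z + t *\<^sub>R y) = \<phi> z + t * t * (norm y)\<^sup>2 - 2 * t * s"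
      unfolding \<phi>_def s_def
      by (simp add: f.scaleR f.add power2_norm_eq_inner inner_simps inner_commute algebra_simps)
    moreover have "t * t * (norm y)\<^sup>2 - 2 * t * s = - (s\<^sup>2 / (norm y)\<^sup>2)"
      using False by (simp add: t_def field_simps power2_eq_square)
    ultimately have "s\<^sup>2 / (norm y)\<^sup>2 \<le> 0"
      by linarith
    then have "s = 0"
      using False by (simp add: divide_le_0_iff)
    then show ?thesis by (simp add: s_def)
  qed simp
  then show ?thesis by blast
qed

section \<open>Complex linear bounded operators\<close>

lemma bounded_opsD: "A \<in> bounded_ops \<Longrightarrow> blinfun_apply A (c *\<^sub>C x) = c *\<^sub>C blinfun_apply A x"
  by (simp add: bounded_ops_def)

lemma scaleC_zero_right [simp]: "c *\<^sub>C (0::'a::complex_vector) = 0"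
  using scaleC_add_right[of c 0 "0::'a"] by simp

lemma scaleC_sum_right: "c *\<^sub>C (\<Sum>i\<in>S. f i) = (\<Sum>i\<in>S. c *\<^sub>C (f i :: 'a::complex_vector))"
  by (induction S rule: infinite_finite_induct) (simp_all add: scaleC_add_right)

lemma bounded_ops_zero [simp]: "0 \<in> bounded_ops"
  by (simp add: bounded_ops_def)

lemma bounded_ops_id [simp]: "id_blinfun \<in> bounded_ops"
  by (simp add: bounded_ops_def)

lemma bounded_ops_add: "A \<in> bounded_ops \<Longrightarrow> B \<in> bounded_ops \<Longrightarrow> A + B \<in> bounded_ops"
  by (simp add: bounded_ops_def blinfun.add_left scaleC_add_right)

lemma bounded_ops_scaleC: "A \<in> bounded_ops \<Longrightarrow> c *\<^sub>C A \<in> bounded_ops"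
  by (simp add: bounded_ops_def scaleC_blinfun.rep_eq scaleC_scaleC mult.commute)

lemma bounded_ops_compose: "A \<in> bounded_ops \<Longrightarrow> B \<in> bounded_ops \<Longrightarrow> A o\<^sub>L B \<in> bounded_ops"
  by (simp add: bounded_ops_def)

lemma bounded_ops_sum: "(\<And>i. i \<in> S \<Longrightarrow> f i \<in> bounded_ops) \<Longrightarrow> (\<Sum>i\<in>S. f i) \<in> bounded_ops"
  by (induction S rule: infinite_finite_induct) (simp_all add: bounded_ops_add)

lemma bounded_ops_scaleR: "A \<in> bounded_ops \<Longrightarrow> r *\<^sub>R A \<in> bounded_ops"
  unfolding scaleR_scaleC by (rule bounded_ops_scaleC)

lemma bounded_ops_diff: "A \<in> bounded_ops \<Longrightarrow> B \<in> bounded_ops \<Longrightarrow> A - B \<in> bounded_ops"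
  using bounded_ops_add[OF _ bounded_ops_scaleR[of B "-1"], of A] by simp

lemma bounded_ops_limit:
  assumes "\<And>n. f n \<in> bounded_ops" and lim: "f \<longlonglongrightarrow> A"
  shows "A \<in> bounded_ops"
proof -
  have "blinfun_apply A (c *\<^sub>C x) = c *\<^sub>C blinfun_apply A x" for c x
  proof (rule LIMSEQ_unique)
    show "(\<lambda>n. blinfun_apply (f n) (c *\<^sub>C x)) \<longlonglongrightarrow> blinfun_apply A (c *\<^sub>C x)"
      by (intro tendsto_intros lim)
    have "(\<lambda>n. c *\<^sub>C blinfun_apply (f n) x) \<longlonglongrightarrow> c *\<^sub>C blinfun_apply A x"
      by (intro bounded_linear.tendsto[OF bounded_linear_scaleC] tendsto_intros lim)
    then show "(\<lambda>n. blinfun_apply (f n) (c *\<^sub>C x)) \<longlonglongrightarrow> c *\<^sub>C blinfun_apply A x"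
      using assms(1) by (simp add: bounded_opsD)
  qed
  then show ?thesis by (simp add: bounded_ops_def)
qed

lemma norm_scaleC_blinfun:
  "norm (c *\<^sub>C (A :: 'a::real_normed_vector \<Rightarrow>\<^sub>L 'b::chilbert_space)) \<le> cmod c * norm A"
  by (rule norm_blinfun_bound)
    (simp_all add: scaleC_blinfun.rep_eq norm_scaleC mult.assoc mult_left_mono norm_blinfun)

lemma bounded_linear_scaleC_blinfun:
  "bounded_linear (\<lambda>A :: 'a::real_normed_vector \<Rightarrow>\<^sub>L 'b::chilbert_space. c *\<^sub>C A)"
proof (rule bounded_linear_intro[where K = "cmod c"])
  fix r and A :: "'a \<Rightarrow>\<^sub>L 'b"
  show "c *\<^sub>C r *\<^sub>R A = r *\<^sub>R c *\<^sub>C A"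
    by (simp add: scaleR_scaleC scaleC_scaleC mult.commute)
qed (simp_all add: scaleC_add_right norm_scaleC_blinfun mult.commute)

lemma scaleC_compose_left: "(c *\<^sub>C A) o\<^sub>L B = c *\<^sub>C (A o\<^sub>L B)"
  by (rule blinfun_eqI) (simp add: scaleC_blinfun.rep_eq)

lemma scaleC_compose_right: "A \<in> bounded_ops \<Longrightarrow> A o\<^sub>L (c *\<^sub>C B) = c *\<^sub>C (A o\<^sub>L B)"
  by (rule blinfun_eqI) (simp add: scaleC_blinfun.rep_eq bounded_opsD)

section \<open>Adjoints\<close>

lemma adj_unique:
  assumes "\<And>x y. cinner (blinfun_apply A x) y = cinner x (blinfun_apply B y)"
  shows "adj A = B"
  unfolding adj_def
proof (rule the_equality)
  fix B' assume B': "\<forall>x y. cinner (blinfun_apply A x) y = cinner x (blinfun_apply B' y)"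
  show "B' = B"
  proof (rule blinfun_eqI, rule cinner_eqI)
    fix y z
    have "cinner z (blinfun_apply B' y) = cinner z (blinfun_apply B y)"
      using B' assms by simp
    then show "cinner (blinfun_apply B' y) z = cinner (blinfun_apply B y) z"
      by (metis cinner_commute)
  qed
qed (use assms in blast)

text \<open>Riesz representation for the real inner product gives a real adjoint \<open>g\<close>.
  Complex linearity of \<open>A\<close> upgrades its defining identity from real parts to the full
  inner product.\<close>

lemma adj_exists:
  fixes A :: "'a::chilbert_space \<Rightarrow>\<^sub>L 'b::chilbert_space"
  assumes A: "A \<in> bounded_ops"
  shows "\<exists>B. \<forall>x y. cinner (blinfun_apply A x) y = cinner x (blinfun_apply B y)"
proof -
  have "\<exists>z. \<forall>x. inner (blinfun_apply A x) y = inner x z" for y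
    by (rule riesz_representation)
      (intro bounded_linear_compose[OF bounded_linear_inner_left] blinfun.bounded_linear_right)
  then obtain g where g: "\<And>x y. inner (blinfun_apply A x) y = inner x (g y)" by metis
  \<comment> \<open>The imaginary part is a real inner product after multiplying by
    \<open>- \<i>\<close>, so the identity for \<open>g\<close> covers it too once the scalar is
    moved through \<open>A\<close>.\<close>
  have Im: "Im (cinner u v) = inner ((- \<i>) *\<^sub>C u) v" for u v :: "'c::chilbert_space"
    by (simp add: Re_cinner[symmetric] cinner_scaleC_left)
  have cg: "cinner (blinfun_apply A x) y = cinner x (g y)" for x y
    by (rule complex_eqI)
      (simp_all add: Re_cinner g Im bounded_opsD[OF A, symmetric])
  have "bounded_linear g"
  proof (rule bounded_linear_intro[where K = "norm A"])
    show "g (x + y) = g x + g y" for x y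
      by (rule vector_eq_rdot[THEN iffD1]) (simp add: inner_add_left inner_add_right g[symmetric] inner_commute[of "g _"])
    show "g (r *\<^sub>R x) = r *\<^sub>R g x" for r x
      by (rule vector_eq_rdot[THEN iffD1]) (simp add: g[symmetric] inner_commute[of "g _"])
    show "norm (g y) \<le> norm y * norm A" for y
    proof (cases "g y = 0")
      case False
      have "norm (g y) * norm (g y) = inner (blinfun_apply A (g y)) y"
        by (simp add: g power2_norm_eq_inner[symmetric] power2_eq_square)
      also have "\<dots> \<le> norm (blinfun_apply A (g y)) * norm y" by (rule norm_cauchy_schwarz)
      also have "\<dots> \<le> norm A * norm (g y) * norm y"
        by (intro mult_right_mono norm_blinfun) simp
      finally show ?thesis using False by (simp add: mult_ac)
    qed simp
  qed
  then show ?thesis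
    by (intro exI[of _ "Blinfun g"]) (simp add: bounded_linear_Blinfun_apply cg)
qed

lemma cinner_adj_right:
  "A \<in> bounded_ops \<Longrightarrow> cinner x (blinfun_apply (adj A) y) = cinner (blinfun_apply A x) y"
  using adj_exists[of A] adj_unique by metis

lemma cinner_adj_left:
  "A \<in> bounded_ops \<Longrightarrow> cinner (blinfun_apply (adj A) y) x = cinner y (blinfun_apply A x)"
  by (metis cinner_adj_right cinner_commute)

lemma adj_bounded_ops: "A \<in> bounded_ops \<Longrightarrow> adj A \<in> bounded_ops"
  unfolding bounded_ops_def[of ] mem_Collect_eq
  by (intro allI cinner_eqI) (simp add: cinner_adj_left bounded_ops_def cinner_scaleC_left)

lemma adj_id [simp]: "adj id_blinfun = id_blinfun"
  by (rule adj_unique) simp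

lemma adj_diff: "A \<in> bounded_ops \<Longrightarrow> B \<in> bounded_ops \<Longrightarrow> adj (A - B) = adj A - adj B"
  by (rule adj_unique)
    (simp add: blinfun.diff_left cinner_diff_left cinner_diff_right cinner_adj_right)

lemma adj_compose: "A \<in> bounded_ops \<Longrightarrow> B \<in> bounded_ops \<Longrightarrow> adj (A o\<^sub>L B) = adj B o\<^sub>L adj A"
  by (rule adj_unique) (simp add: cinner_adj_right)

lemma norm_adj_le:
  assumes A: "A \<in> bounded_ops"
  shows "norm (adj A) \<le> norm A"
proof (rule norm_blinfun_bound)
  fix y
  let ?z = "blinfun_apply (adj A) y"
  show "norm ?z \<le> norm A * norm y"
  proof (cases "?z = 0")
    case False
    have "norm ?z * norm ?z = cmod (cinner ?z ?z)"
      unfolding cinner_self by (simp add: power2_eq_square norm_mult)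
    also have "\<dots> = cmod (cinner (blinfun_apply A ?z) y)"
      by (simp add: cinner_adj_right[OF A])
    also have "\<dots> \<le> norm (blinfun_apply A ?z) * norm y" by (rule norm_cinner_le)
    also have "\<dots> \<le> norm A * norm ?z * norm y"
      by (intro mult_right_mono norm_blinfun) simp
    finally show ?thesis using False by (simp add: mult_ac)
  qed simp
qed simp

text \<open>On complex linear operators \<open>adj\<close> is additive and contractive, hence
  continuous. For merely real linear maps the description in \<open>adj\<close> need not denote an
  adjoint, so complex linearity of all terms is assumed.\<close>

lemma tendsto_adj:
  assumes "\<And>n. f n \<in> bounded_ops" and lim: "f \<longlonglongrightarrow> A"
  shows "(\<lambda>n. adj (f n)) \<longlonglongrightarrow> adj A"
proof -
  have A: "A \<in> bounded_ops" by (rule bounded_ops_limit[OF assms])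
  have "(\<lambda>n. norm (f n - A)) \<longlonglongrightarrow> 0"
    using lim by (simp add: LIM_zero_iff tendsto_norm_zero_iff)
  then have "(\<lambda>n. adj (f n) - adj A) \<longlonglongrightarrow> 0"
    by (rule Lim_null_comparison[rotated])
      (use assms(1) A in \<open>simp add: adj_diff[symmetric] norm_adj_le bounded_ops_diff\<close>)
  then show ?thesis by (simp add: LIM_zero_iff)
qed

section \<open>Operator matrices and positive semidefinite forms\<close>

text \<open>A crude bound by the sum of the entry norms, which ensures that the supremum defining
  \<open>op_matrix_norm\<close> is a genuine one.\<close>

lemma op_matrix_norm_bdd:
  "bdd_above {L2_set (\<lambda>i. norm (\<Sum>j<(k::nat). blinfun_apply (M i j) (x j))) {..<k} | x.
                L2_set (\<lambda>j. norm (x j)) {..<k} \<le> 1}"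
proof (rule bdd_aboveI)
  fix r assume "r \<in> {L2_set (\<lambda>i. norm (\<Sum>j<k. blinfun_apply (M i j) (x j))) {..<k} | x.
                L2_set (\<lambda>j. norm (x j)) {..<k} \<le> 1}"
  then obtain x where r: "r = L2_set (\<lambda>i. norm (\<Sum>j<k. blinfun_apply (M i j) (x j))) {..<k}"
    and x: "L2_set (\<lambda>j. norm (x j)) {..<k} \<le> 1" by (elim CollectE exE conjE)
  have x1: "norm (x j) \<le> 1" if "j < k" for j
    by (rule order_trans[OF member_le_L2_set[of "{..<k}" j "\<lambda>j. norm (x j)"] x]) (simp_all add: that)
  have "norm (blinfun_apply (M i j) (x j)) \<le> norm (M i j)" if "j < k" for i j
    using order_trans[OF norm_blinfun mult_left_mono[OF x1[OF that] norm_ge_zero]] by simp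
  then have "(\<Sum>i<k. norm (\<Sum>j<k. blinfun_apply (M i j) (x j))) \<le> (\<Sum>i<k. \<Sum>j<k. norm (M i j))"
    by (intro sum_mono order_trans[OF norm_sum]) simp
  then show "r \<le> (\<Sum>i<k. \<Sum>j<k. norm (M i j))"
    unfolding r by (rule order_trans[OF L2_set_le_sum, rotated]) simp
qed

lemma op_matrix_normI:
  assumes "\<And>x. L2_set (\<lambda>j. norm (x j)) {..<k} \<le> 1 \<Longrightarrow>
    L2_set (\<lambda>i. norm (\<Sum>j<k. blinfun_apply (M i j) (x j))) {..<k} \<le> N"
  shows "op_matrix_norm k M \<le> N"
  unfolding op_matrix_norm_def
proof (rule cSup_least)
  have "L2_set (\<lambda>i. norm (\<Sum>j<k. blinfun_apply (M i j) ((\<lambda>_. 0::'a) j))) {..<k}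
      \<in> {L2_set (\<lambda>i. norm (\<Sum>j<k. blinfun_apply (M i j) (x j))) {..<k} | x.
            L2_set (\<lambda>j. norm (x j)) {..<k} \<le> 1}"
    by (rule CollectI, rule exI[of _ "\<lambda>_. 0"]) (simp add: L2_set_def)
  then show "{L2_set (\<lambda>i. norm (\<Sum>j<k. blinfun_apply (M i j) (x j))) {..<k} | x.
                L2_set (\<lambda>j. norm (x j)) {..<k} \<le> 1} \<noteq> {}" by (metis empty_iff)
  fix r assume "r \<in> {L2_set (\<lambda>i. norm (\<Sum>j<k. blinfun_apply (M i j) (x j))) {..<k} | x.
                L2_set (\<lambda>j. norm (x j)) {..<k} \<le> 1}"
  then obtain x where "r = L2_set (\<lambda>i. norm (\<Sum>j<k. blinfun_apply (M i j) (x j))) {..<k}"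
    and "L2_set (\<lambda>j. norm (x j)) {..<k} \<le> 1" by (elim CollectE exE conjE)
  then show "r \<le> N" using assms by simp
qed

lemma op_matrix_norm_upper:
  "L2_set (\<lambda>j. norm (x j)) {..<k} \<le> 1 \<Longrightarrow>
    L2_set (\<lambda>i. norm (\<Sum>j<k. blinfun_apply (M i j) (x j))) {..<k} \<le> op_matrix_norm k M"
  unfolding op_matrix_norm_def
  by (rule cSup_upper[OF _ op_matrix_norm_bdd], rule CollectI, rule exI[of _ x]) simp

lemma op_matrix_norm_nonneg: "0 \<le> op_matrix_norm k M"
  using op_matrix_norm_upper[of "\<lambda>_. 0" k M] by (simp add: L2_set_def)

lemma op_matrix_norm_apply:
  "L2_set (\<lambda>i. norm (\<Sum>j<k. blinfun_apply (M i j) (x j))) {..<k}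
     \<le> op_matrix_norm k M * L2_set (\<lambda>j. norm (x j)) {..<k}"
proof (cases "L2_set (\<lambda>j. norm (x j)) {..<k} = 0")
  case True
  then have "x j = 0" if "j < k" for j
    using that by (simp add: L2_set_eq_0_iff)
  then show ?thesis using True by (simp add: L2_set_def)
next
  case False
  define r where "r = L2_set (\<lambda>j. norm (x j)) {..<k}"
  have r: "r > 0" using False by (simp add: r_def less_le eq_commute[of 0])
  have scale: "L2_set (\<lambda>j. norm ((1/r) *\<^sub>R y j)) {..<k} = L2_set (\<lambda>j. norm (y j)) {..<k} / r"
    for y :: "nat \<Rightarrow> 'c::real_normed_vector"
    using r L2_set_right_distrib[of "1/r" "\<lambda>j. norm (y j)" "{..<k}"] by simp
  have "L2_set (\<lambda>i. norm (\<Sum>j<k. blinfun_apply (M i j) (x j))) {..<k} / r \<le> op_matrix_norm k M"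
    using op_matrix_norm_upper[of "\<lambda>j. (1/r) *\<^sub>R x j" k M] r
    by (simp only: scale blinfun.scaleR_right scaleR_sum_right[symmetric] r_def[symmetric]) simp
  then show ?thesis using r by (simp add: r_def[symmetric] field_simps)
qed

lemma op_matrix_norm_form:
  "cmod (\<Sum>i<k. \<Sum>j<k. cinner (blinfun_apply (M i j) (x j)) (y i))
     \<le> op_matrix_norm k M * L2_set (\<lambda>j. norm (x j)) {..<k} * L2_set (\<lambda>i. norm (y i)) {..<k}"
proof -
  let ?u = "\<lambda>i. \<Sum>j<k. blinfun_apply (M i j) (x j)"
  have "cmod (\<Sum>i<k. \<Sum>j<k. cinner (blinfun_apply (M i j) (x j)) (y i)) = cmod (\<Sum>i<k. cinner (?u i) (y i))"
    by (simp add: cinner_sum_left)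
  also have "\<dots> \<le> (\<Sum>i<k. norm (?u i) * norm (y i))"
    by (intro order_trans[OF norm_sum] sum_mono norm_cinner_le)
  also have "\<dots> \<le> L2_set (\<lambda>i. norm (?u i)) {..<k} * L2_set (\<lambda>i. norm (y i)) {..<k}"
    using L2_set_mult_ineq[of "\<lambda>i. norm (?u i)" "\<lambda>i. norm (y i)" "{..<k}"] by simp
  also have "\<dots> \<le> op_matrix_norm k M * L2_set (\<lambda>j. norm (x j)) {..<k} * L2_set (\<lambda>i. norm (y i)) {..<k}"
    by (intro mult_right_mono op_matrix_norm_apply L2_set_nonneg)
  finally show ?thesis .
qed

text \<open>Testing the form against \<open>y = M x\<close> recovers the norm of \<open>M x\<close>.
  This formulation suits purity, which is a statement about weak limits and so yields inner products
  only.\<close>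

lemma op_matrix_norm_le_formI:
  assumes N: "0 \<le> N"
    and form: "\<And>x y. cmod (\<Sum>i<k. \<Sum>j<k. cinner (blinfun_apply (M i j) (x j)) (y i))
       \<le> N * L2_set (\<lambda>j. norm (x j)) {..<k} * L2_set (\<lambda>i. norm (y i)) {..<k}"
  shows "op_matrix_norm k M \<le> N"
proof (rule op_matrix_normI)
  fix x :: "nat \<Rightarrow> 'a" assume x: "L2_set (\<lambda>j. norm (x j)) {..<k} \<le> 1"
  define u where "u i = (\<Sum>j<k. blinfun_apply (M i j) (x j))" for i
  define r where "r = L2_set (\<lambda>i. norm (u i)) {..<k}"
  have r0: "0 \<le> r" by (simp add: r_def)
  have "(\<Sum>i<k. \<Sum>j<k. cinner (blinfun_apply (M i j) (x j)) (u i)) = (\<Sum>i<k. cinner (u i) (u i))"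
    by (simp add: u_def cinner_sum_left)
  also have "\<dots> = complex_of_real (r\<^sup>2)"
    by (simp add: cinner_self r_def L2_set_def sum_nonneg)
  finally have "r\<^sup>2 \<le> N * L2_set (\<lambda>j. norm (x j)) {..<k} * r"
    using form[of x u] by (simp add: r_def norm_power)
  also have "\<dots> \<le> N * 1 * r"
    by (intro mult_right_mono mult_left_mono x N r0)
  finally have "r * r \<le> N * r" by (simp add: power2_eq_square)
  then have "r \<le> N"
    using r0 N by (cases "r = 0") simp_all
  then show "L2_set (\<lambda>i. norm (\<Sum>j<k. blinfun_apply (M i j) (x j))) {..<k} \<le> N"
    by (simp add: r_def u_def)
qed

text \<open>Through this identity, inequalities between single operators are the 1 by 1 case of
  inequalities between operator matrices.\<close>

lemma op_matrix_norm_1: "op_matrix_norm 1 M = norm (M 0 0)"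
proof (rule antisym)
  show "op_matrix_norm 1 M \<le> norm (M 0 0)"
  proof (rule op_matrix_normI)
    fix x :: "nat \<Rightarrow> 'a" assume "L2_set (\<lambda>j. norm (x j)) {..<1} \<le> 1"
    then have "norm (x 0) \<le> 1" by (simp add: L2_set_def)
    then have "norm (blinfun_apply (M 0 0) (x 0)) \<le> norm (M 0 0)"
      using order_trans[OF norm_blinfun mult_left_mono[OF _ norm_ge_zero]] by fastforce
    then show "L2_set (\<lambda>i. norm (\<Sum>j<1. blinfun_apply (M i j) (x j))) {..<1} \<le> norm (M 0 0)"
      by (simp add: L2_set_def)
  qed
  show "norm (M 0 0) \<le> op_matrix_norm 1 M"
  proof (rule norm_blinfun_bound[OF op_matrix_norm_nonneg])
    show "norm (blinfun_apply (M 0 0) y) \<le> op_matrix_norm 1 M * norm y" for y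
      using op_matrix_norm_apply[of M "\<lambda>_. y" 1] by (simp only: lessThan_Suc lessThan_0 One_nat_def) (simp add: L2_set_def)
  qed
qed

text \<open>Splitting \<open>M\<close> into \<open>M'\<close> and the difference gives a
  quantitative form of the continuity of the matrix norm in its entries.\<close>

lemma op_matrix_norm_perturb:
  "op_matrix_norm k M \<le> op_matrix_norm k M' + (\<Sum>i<k. \<Sum>j<k. norm (M i j - M' i j))"
proof (rule op_matrix_normI)
  fix x :: "nat \<Rightarrow> 'a" assume x: "L2_set (\<lambda>j. norm (x j)) {..<k} \<le> 1"
  have x1: "norm (x j) \<le> 1" if "j < k" for j
    by (rule order_trans[OF member_le_L2_set[of "{..<k}" j "\<lambda>j. norm (x j)"] x]) (simp_all add: that)
  let ?u = "\<lambda>i. \<Sum>j<k. blinfun_apply (M' i j) (x j)"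
  let ?v = "\<lambda>i. \<Sum>j<k. blinfun_apply (M i j - M' i j) (x j)"
  have "L2_set (\<lambda>i. norm (\<Sum>j<k. blinfun_apply (M i j) (x j))) {..<k} = L2_set (\<lambda>i. norm (?u i + ?v i)) {..<k}"
    by (simp add: sum_subtractf blinfun.diff_left)
  also have "\<dots> \<le> L2_set (\<lambda>i. norm (?u i) + norm (?v i)) {..<k}"
    by (intro L2_set_mono norm_triangle_ineq) simp
  also have "\<dots> \<le> L2_set (\<lambda>i. norm (?u i)) {..<k} + L2_set (\<lambda>i. norm (?v i)) {..<k}"
    by (rule L2_set_triangle_ineq)
  also have "\<dots> \<le> op_matrix_norm k M' + (\<Sum>i<k. \<Sum>j<k. norm (M i j - M' i j))"
  proof (rule add_mono)
    have "norm (blinfun_apply (M i j - M' i j) (x j)) \<le> norm (M i j - M' i j)" if "j < k" for i j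
      using order_trans[OF norm_blinfun mult_left_mono[OF x1[OF that] norm_ge_zero]] by simp
    then have "(\<Sum>i<k. norm (?v i)) \<le> (\<Sum>i<k. \<Sum>j<k. norm (M i j - M' i j))"
      by (intro sum_mono order_trans[OF norm_sum]) simp
    then show "L2_set (\<lambda>i. norm (?v i)) {..<k} \<le> (\<Sum>i<k. \<Sum>j<k. norm (M i j - M' i j))"
      by (rule order_trans[OF L2_set_le_sum, rotated]) simp
  qed (rule op_matrix_norm_upper[OF x])
  finally show "L2_set (\<lambda>i. norm (\<Sum>j<k. blinfun_apply (M i j) (x j))) {..<k}
    \<le> op_matrix_norm k M' + (\<Sum>i<k. \<Sum>j<k. norm (M i j - M' i j))" .
qed

lemma op_matrix_norm_limit_le:
  assumes M: "\<And>i j. i < k \<Longrightarrow> j < k \<Longrightarrow> (\<lambda>n. M n i j) \<longlonglongrightarrow> M' i j"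
    and N: "\<And>i j. i < k \<Longrightarrow> j < k \<Longrightarrow> (\<lambda>n. N n i j) \<longlonglongrightarrow> N' i j"
    and le: "\<And>n. op_matrix_norm k (M n) \<le> op_matrix_norm k (N n)"
  shows "op_matrix_norm k M' \<le> op_matrix_norm k N'"
proof (rule tendsto_lowerbound)
  \<comment> \<open>The total error of two perturbations: one from \<open>M'\<close> to
    \<open>M n\<close> on the left of \<open>le\<close>, one from \<open>N n\<close> to
    \<open>N'\<close> on its right.\<close>
  let ?e = "\<lambda>n. (\<Sum>i<k. \<Sum>j<k. norm (N n i j - N' i j)) + (\<Sum>i<k. \<Sum>j<k. norm (M' i j - M n i j))"
  have "(\<lambda>n. norm (N n i j - N' i j)) \<longlonglongrightarrow> 0" "(\<lambda>n. norm (M' i j - M n i j)) \<longlonglongrightarrow> 0"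
    if "i < k" "j < k" for i j
    using tendsto_norm[OF tendsto_diff[OF N[OF that] tendsto_const[of "N' i j"]]]
      tendsto_norm[OF tendsto_diff[OF tendsto_const[of "M' i j"] M[OF that]]] by simp_all
  then have "?e \<longlonglongrightarrow> (\<Sum>i<k. \<Sum>j<k. 0) + (\<Sum>i<k. \<Sum>j<k. 0)"
    by (intro tendsto_add tendsto_sum) simp_all
  then show "(\<lambda>n. op_matrix_norm k N' + ?e n) \<longlonglongrightarrow> op_matrix_norm k N'"
    using tendsto_add[OF tendsto_const[of "op_matrix_norm k N'"]] by fastforce
  show "\<forall>\<^sub>F n in sequentially. op_matrix_norm k M' \<le> op_matrix_norm k N' + ?e n"
  proof (rule always_eventually, rule allI)
    fix n
    show "op_matrix_norm k M' \<le> op_matrix_norm k N' + ?e n"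
      using op_matrix_norm_perturb[of k M' "M n"] le[of n] op_matrix_norm_perturb[of k "N n" N']
      by linarith
  qed
qed simp

section \<open>Positive semidefinite sesquilinear forms and their factorization on finite
  sets\<close>

definition psd_form :: "('a::complex_vector \<Rightarrow> 'a \<Rightarrow> complex) \<Rightarrow> bool" where
  "psd_form B \<longleftrightarrow> (\<forall>x y z. B (x + y) z = B x z + B y z) \<and> (\<forall>c x y. B (c *\<^sub>C x) y = c * B x y) \<and>
     (\<forall>x y. B y x = cnj (B x y)) \<and> (\<forall>x. 0 \<le> Re (B x x))"

context
  fixes B :: "'a::complex_vector \<Rightarrow> 'a \<Rightarrow> complex"
  assumes B: "psd_form B"
begin

lemma psd_form_add_left: "B (x + y) z = B x z + B y z"
  and psd_form_scaleC_left: "B (c *\<^sub>C x) y = c * B x y"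
  and psd_form_cnj: "cnj (B x y) = B y x"
  and psd_form_nonneg: "0 \<le> Re (B x x)"
  using B unfolding psd_form_def by metis+

lemma psd_form_add_right: "B x (y + z) = B x y + B x z"
  by (subst (1 2 3) psd_form_cnj[symmetric]) (simp add: psd_form_add_left)

lemma psd_form_scaleC_right: "B x (c *\<^sub>C y) = cnj c * B x y"
  by (subst (1 2) psd_form_cnj[symmetric]) (simp add: psd_form_scaleC_left)

lemma psd_form_self: "B x x = complex_of_real (Re (B x x))"
  using psd_form_cnj[of x x] by (simp add: complex_eq_iff)

text \<open>Along \<open>u\<close> the form has no quadratic term, so a nonzero linear term would
  make it negative somewhere on the line through \<open>y\<close> in direction
  \<open>u\<close>.\<close>

lemma psd_form_null:
  assumes "B u u = 0"
  shows "B u y = 0"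
proof (rule ccontr)
  assume nz: "B u y \<noteq> 0"
  \<comment> \<open>The numbers \<open>s\<close> and \<open>t\<close> are tuned so that the form
    takes the value -1 at \<open>y + c *\<^sub>C u\<close>.\<close>
  define s where "s = Re (B y y) + 1"
  define t where "t = s / (2 * (cmod (B u y))\<^sup>2)"
  define c where "c = - complex_of_real t * cnj (B u y)"
  have "B (y + c *\<^sub>C u) (y + c *\<^sub>C u) = B y y + c * B u y + cnj (c * B u y)"
    using assms by (simp add: psd_form_add_left psd_form_add_right psd_form_scaleC_left
        psd_form_scaleC_right psd_form_cnj)
  then have "Re (B (y + c *\<^sub>C u) (y + c *\<^sub>C u)) = Re (B y y) + 2 * Re (c * B u y)"
    by simp
  also have "c * B u y = - complex_of_real (t * (cmod (B u y))\<^sup>2)"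
    unfolding c_def of_real_mult complex_norm_square by (simp only: mult_ac minus_mult_left)
  also have "t * (cmod (B u y))\<^sup>2 = s / 2"
    using nz by (simp add: t_def)
  finally have "Re (B (y + c *\<^sub>C u) (y + c *\<^sub>C u)) = - 1"
    by (simp add: s_def field_simps)
  then show False using psd_form_nonneg[of "y + c *\<^sub>C u"] by linarith
qed

text \<open>This is the Schur complement: its value at \<open>x\<close> is the value of
  \<open>B\<close> at \<open>x\<close> minus the projection of \<open>x\<close> to \<open>u\<close>.
  If \<open>B u u = 0\<close>, division by zero gives 0 and \<open>B\<close> is left
  unchanged.\<close>

lemma psd_form_deflate: "psd_form (\<lambda>x y. B x y - B x u * B u y / B u u)"
  unfolding psd_form_def
proof (intro conjI allI)
  fix x
  show "0 \<le> Re (B x x - B x u * B u x / B u u)"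
  proof (cases "B u u = 0")
    case False
    define c where "c = - (B x u / B u u)"
    have cc: "cnj c = - (B u x / B u u)"
      by (simp add: c_def psd_form_cnj)
    have "B (x + c *\<^sub>C u) (x + c *\<^sub>C u) = B x x + cnj c * B x u + c * B u x + c * cnj c * B u u"
      by (simp add: psd_form_add_left psd_form_add_right psd_form_scaleC_left
        psd_form_scaleC_right algebra_simps)
    also have "\<dots> = B x x - B x u * B u x / B u u"
      unfolding cc using False by (simp add: c_def)
    finally show ?thesis using psd_form_nonneg by metis
  qed (simp add: psd_form_nonneg)
qed (simp_all add: psd_form_add_left psd_form_scaleC_left psd_form_cnj algebra_simps add_divide_distrib mult.commute)

end

text \<open>Each vector of \<open>S\<close> is split off by one step of Gaussian
  elimination, which leaves a positive semidefinite remainder.\<close>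

lemma psd_form_cholesky:
  assumes "finite S" and B: "psd_form B"
  shows "\<exists>\<phi>. psd_form (\<lambda>x y. B x y - (\<Sum>u\<in>S. \<phi> u x * cnj (\<phi> u y))) \<and>
           (\<forall>s\<in>S. \<forall>y. B s y = (\<Sum>u\<in>S. \<phi> u s * cnj (\<phi> u y)))"
  using assms(1)
proof (induction S rule: finite_induct)
  case (insert u S)
  then obtain \<phi> where psd: "psd_form (\<lambda>x y. B x y - (\<Sum>u\<in>S. \<phi> u x * cnj (\<phi> u y)))"
    and eq: "\<forall>s\<in>S. \<forall>y. B s y = (\<Sum>u\<in>S. \<phi> u s * cnj (\<phi> u y))" by blast
  \<comment> \<open>\<open>C\<close> is the remainder after the pivots in \<open>S\<close>; it
    already vanishes when its first argument lies in \<open>S\<close>.\<close>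
  define C where "C x y = B x y - (\<Sum>u\<in>S. \<phi> u x * cnj (\<phi> u y))" for x y
  have C: "psd_form C" using psd by (simp add: C_def[abs_def])
  have C0: "C s y = 0" if "s \<in> S" for s y using eq that by (simp add: C_def)
  \<comment> \<open>The functional for the new pivot is the column of \<open>u\<close> in
    \<open>C\<close>, normalized by the square root of the pivot. For a zero pivot it is the zero
    functional, again by division by zero.\<close>
  define \<psi> where "\<psi> = \<phi>(u := \<lambda>x. C x u / complex_of_real (sqrt (Re (C u u))))"
  have "\<psi> u x * cnj (\<psi> u y) = C x u * C u y / complex_of_real (Re (C u u))" for x y
    using psd_form_nonneg[OF C, of u]
    by (simp add: \<psi>_def psd_form_cnj[OF C] of_real_mult[symmetric] del: of_real_mult)
  then have \<psi>u: "\<psi> u x * cnj (\<psi> u y) = C x u * C u y / C u u" for x y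
    using psd_form_self[OF C, of u] by simp
  have "(\<Sum>v\<in>insert u S. \<psi> v x * cnj (\<psi> v y)) = \<psi> u x * cnj (\<psi> u y) + (\<Sum>v\<in>S. \<phi> v x * cnj (\<phi> v y))" for x y
    using insert.hyps by (simp add: \<psi>_def) (intro sum.cong, auto)
  then have diff: "B x y - (\<Sum>v\<in>insert u S. \<psi> v x * cnj (\<psi> v y)) = C x y - C x u * C u y / C u u" for x y
    unfolding \<psi>u C_def by simp
  \<comment> \<open>Elimination clears the row of a nonzero pivot; the row of a zero pivot was zero
    already by \<open>psd_form_null\<close>.\<close>
  have "C u y - C u u * C u y / C u u = 0" for y
    using psd_form_null[OF C, of u y] by (cases "C u u = 0") simp_all
  moreover have "C s y - C s u * C u y / C u u = 0" if "s \<in> S" for s y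
    using C0[OF that] by simp
  ultimately have zero: "B s y - (\<Sum>v\<in>insert u S. \<psi> v s * cnj (\<psi> v y)) = 0" if "s \<in> insert u S" for s y
    unfolding diff using that by blast
  show ?case
  proof (intro exI conjI ballI allI)
    show "psd_form (\<lambda>x y. B x y - (\<Sum>v\<in>insert u S. \<psi> v x * cnj (\<psi> v y)))"
      unfolding diff by (rule psd_form_deflate[OF C])
    show "B s y = (\<Sum>v\<in>insert u S. \<psi> v s * cnj (\<psi> v y))" if "s \<in> insert u S" for s y
      using zero[OF that, of y] by (simp only: right_minus_eq)
  qed
qed (use B in simp)

section \<open>The standard orthonormal basis\<close>

lemma ell2_coeff_basis: "ell2_coeff (ell2_basis i) j = (if j = i then 1 else 0)"
  by (simp add: ell2_basis.rep_eq)

lemma cinner_ell2_basis_right: "cinner x (ell2_basis i) = ell2_coeff x i"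
proof -
  have "(\<Sum>\<^sub>\<infinity>j. ell2_coeff x j * cnj (ell2_coeff (ell2_basis i) j)) = (\<Sum>\<^sub>\<infinity>j\<in>{i}. ell2_coeff x j)"
    by (rule infsum_cong_neutral) (simp_all add: ell2_coeff_basis)
  then show ?thesis by (simp add: cinner_ell2_def ell2_cinner_def)
qed

lemma ell2_eqI: "(\<And>i. cinner x (ell2_basis i) = cinner y (ell2_basis i)) \<Longrightarrow> x = y"
  by (simp add: cinner_ell2_basis_right ell2_coeff_inject[symmetric] fun_eq_iff)

lemma cinner_ell2_basis: "cinner (ell2_basis i) (ell2_basis j) = (if i = j then 1 else 0)"
  by (simp add: cinner_ell2_basis_right ell2_coeff_basis)

lemma norm_sum_ell2_basis:
  assumes "finite F"
  shows "(norm (\<Sum>s\<in>F. c s *\<^sub>C ell2_basis s))\<^sup>2 = (\<Sum>s\<in>F. (cmod (c s))\<^sup>2)"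
proof -
  have "complex_of_real ((norm (\<Sum>s\<in>F. c s *\<^sub>C ell2_basis s))\<^sup>2)
      = (\<Sum>s\<in>F. \<Sum>t\<in>F. c s * cnj (c t) * (if s = t then 1 else 0))"
    unfolding cinner_self[symmetric] cinner_sum_left cinner_sum_right
    by (subst sum.swap) (simp add: cinner_scaleC_left cinner_scaleC_right cinner_ell2_basis mult_ac)
  also have "\<dots> = (\<Sum>s\<in>F. c s * cnj (c s))"
    using assms by (simp add: if_distrib sum.delta cong: if_cong)
  also have "\<dots> = complex_of_real (\<Sum>s\<in>F. (cmod (c s))\<^sup>2)"
    unfolding of_real_sum complex_norm_square ..
  finally show ?thesis by (simp only: of_real_eq_iff)
qed

text \<open>The coefficients of \<open>adj A\<close> applied to \<open>y\<close> are inner products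
  of \<open>y\<close> with the values of \<open>A\<close> on the basis. Hence those values determine
  the adjoint, and the adjoint determines \<open>A\<close>.\<close>

lemma bounded_ops_ell2_eqI:
  assumes A: "A \<in> bounded_ops" and B: "B \<in> bounded_ops"
    and eq: "\<And>i. blinfun_apply A (ell2_basis i) = blinfun_apply B (ell2_basis i)"
  shows "A = B"
proof -
  have "blinfun_apply (adj A) y = blinfun_apply (adj B) y" for y
    by (rule ell2_eqI) (simp add: cinner_adj_left A B eq)
  then have "cinner (blinfun_apply A x) y = cinner (blinfun_apply B x) y" for x y
    by (metis A B cinner_adj_right)
  then show ?thesis by (intro blinfun_eqI cinner_eqI)
qed

section \<open>The universal model\<close>

text \<open>This is the statement that tensoring \<open>M\<close> with an identity does not increase
  its norm, tested on finite sums of elementary tensors of basis vectors with vectors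
  \<open>v s j\<close> and \<open>w t i\<close>, where the second tensor factor carries the form
  \<open>B\<close>. Factorizing \<open>B\<close> on these vectors splits the expression into
  finitely many copies of the form of \<open>M\<close>.\<close>

lemma ell2_ampliation_bound:
  fixes M :: "nat \<Rightarrow> nat \<Rightarrow> ('i ell2 \<Rightarrow>\<^sub>L 'i ell2)"
    and v w :: "'i \<Rightarrow> nat \<Rightarrow> 'a::complex_vector"
  assumes F: "finite F" and B: "psd_form B"
    and M: "\<And>i j. i < k \<Longrightarrow> j < k \<Longrightarrow> M i j \<in> bounded_ops"
  shows "cmod (\<Sum>i<k. \<Sum>j<k. \<Sum>s\<in>F. \<Sum>t\<in>F.
            cinner (blinfun_apply (M i j) (ell2_basis s)) (ell2_basis t) * B (v s j) (w t i))
    \<le> op_matrix_norm k M * sqrt (\<Sum>j<k. \<Sum>s\<in>F. Re (B (v s j) (v s j)))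
        * sqrt (\<Sum>i<k. \<Sum>t\<in>F. Re (B (w t i) (w t i)))"
proof -
  \<comment> \<open>All vectors at which \<open>B\<close> is evaluated, so that the factorization is
    exact wherever it is used.\<close>
  define S where "S = (\<lambda>(s, j). v s j) ` (F \<times> {..<k}) \<union> (\<lambda>(s, j). w s j) ` (F \<times> {..<k})"
  have finS: "finite S" using F by (simp add: S_def)
  have vS: "v s j \<in> S" and wS: "w s j \<in> S" if "s \<in> F" "j < k" for s j
    using that by (auto simp: S_def)
  obtain \<phi> where \<phi>: "\<And>s y. s \<in> S \<Longrightarrow> B s y = (\<Sum>u\<in>S. \<phi> u s * cnj (\<phi> u y))"
    using psd_form_cholesky[OF finS B] by blast
  \<comment> \<open>\<open>\<xi> u z j\<close> is the component with index \<open>u\<close> of the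
    sum over \<open>s\<close> of the tensors of \<open>ell2_basis s\<close> with
    \<open>z s j\<close>. By the factorization, the squared norms of these components add up to the
    values of \<open>B\<close>.\<close>
  define \<xi> where "\<xi> u z j = (\<Sum>s\<in>F. \<phi> u (z s j) *\<^sub>C ell2_basis s)" for u and z :: "'i \<Rightarrow> nat \<Rightarrow> 'a" and j
  have norm_\<xi>: "(\<Sum>u\<in>S. (L2_set (\<lambda>j. norm (\<xi> u z j)) {..<k})\<^sup>2) = (\<Sum>j<k. \<Sum>s\<in>F. Re (B (z s j) (z s j)))"
    if z: "\<And>s j. s \<in> F \<Longrightarrow> j < k \<Longrightarrow> z s j \<in> S" for z
  proof -
    have "(\<Sum>u\<in>S. (L2_set (\<lambda>j. norm (\<xi> u z j)) {..<k})\<^sup>2)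
        = (\<Sum>u\<in>S. \<Sum>j<k. \<Sum>s\<in>F. (cmod (\<phi> u (z s j)))\<^sup>2)"
      by (simp add: L2_set_def sum_nonneg \<xi>_def norm_sum_ell2_basis F)
    also have "\<dots> = (\<Sum>j<k. \<Sum>s\<in>F. \<Sum>u\<in>S. (cmod (\<phi> u (z s j)))\<^sup>2)"
      by (subst sum.swap, intro sum.cong refl, rule sum.swap)
    also have "\<dots> = (\<Sum>j<k. \<Sum>s\<in>F. Re (B (z s j) (z s j)))"
    proof (intro sum.cong refl)
      fix s j assume "j \<in> {..<k}" "s \<in> F"
      then have "B (z s j) (z s j) = complex_of_real (\<Sum>u\<in>S. (cmod (\<phi> u (z s j)))\<^sup>2)"
        unfolding of_real_sum complex_norm_square using z by (simp add: \<phi>)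
      then show "(\<Sum>u\<in>S. (cmod (\<phi> u (z s j)))\<^sup>2) = Re (B (z s j) (z s j))" by simp
    qed
    finally show ?thesis .
  qed
  have "(\<Sum>s\<in>F. \<Sum>t\<in>F. cinner (blinfun_apply (M i j) (ell2_basis s)) (ell2_basis t) * B (v s j) (w t i))
      = (\<Sum>u\<in>S. cinner (blinfun_apply (M i j) (\<xi> u v j)) (\<xi> u w i))" if "i < k" "j < k" for i j
  proof -
    have "(\<Sum>s\<in>F. \<Sum>t\<in>F. cinner (blinfun_apply (M i j) (ell2_basis s)) (ell2_basis t) * B (v s j) (w t i))
       = (\<Sum>s\<in>F. \<Sum>t\<in>F. \<Sum>u\<in>S. \<phi> u (v s j) * cnj (\<phi> u (w t i))
            * cinner (blinfun_apply (M i j) (ell2_basis s)) (ell2_basis t))"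
      using that by (intro sum.cong refl) (simp add: \<phi> vS sum_distrib_left mult_ac)
    also have "\<dots> = (\<Sum>u\<in>S. \<Sum>s\<in>F. \<Sum>t\<in>F. \<phi> u (v s j) * cnj (\<phi> u (w t i))
            * cinner (blinfun_apply (M i j) (ell2_basis s)) (ell2_basis t))"
      by (rule trans[OF sum.cong[OF refl sum.swap] sum.swap])
    also have "\<dots> = (\<Sum>u\<in>S. \<Sum>t\<in>F. \<Sum>s\<in>F. \<phi> u (v s j) * cnj (\<phi> u (w t i))
            * cinner (blinfun_apply (M i j) (ell2_basis s)) (ell2_basis t))"
      by (rule sum.cong[OF refl sum.swap])
    also have "\<dots> = (\<Sum>u\<in>S. cinner (blinfun_apply (M i j) (\<xi> u v j)) (\<xi> u w i))"
      by (simp add: sum_distrib_left \<xi>_def blinfun.sum_right cinner_sum_left cinner_sum_right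
          bounded_opsD[OF M[OF that]] cinner_scaleC_left cinner_scaleC_right mult_ac)
    finally show ?thesis .
  qed
  then have "(\<Sum>i<k. \<Sum>j<k. \<Sum>s\<in>F. \<Sum>t\<in>F.
            cinner (blinfun_apply (M i j) (ell2_basis s)) (ell2_basis t) * B (v s j) (w t i))
      = (\<Sum>i<k. \<Sum>j<k. \<Sum>u\<in>S. cinner (blinfun_apply (M i j) (\<xi> u v j)) (\<xi> u w i))"
    by simp
  also have "\<dots> = (\<Sum>u\<in>S. \<Sum>i<k. \<Sum>j<k. cinner (blinfun_apply (M i j) (\<xi> u v j)) (\<xi> u w i))"
    by (rule trans[OF sum.cong[OF refl sum.swap] sum.swap])
  also have "cmod \<dots> \<le> (\<Sum>u\<in>S. op_matrix_norm k M * L2_set (\<lambda>j. norm (\<xi> u v j)) {..<k}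
       * L2_set (\<lambda>i. norm (\<xi> u w i)) {..<k})"
    by (intro order_trans[OF norm_sum] sum_mono op_matrix_norm_form)
  also have "\<dots> = op_matrix_norm k M * (\<Sum>u\<in>S. \<bar>L2_set (\<lambda>j. norm (\<xi> u v j)) {..<k}\<bar>
       * \<bar>L2_set (\<lambda>i. norm (\<xi> u w i)) {..<k}\<bar>)"
    by (simp add: sum_distrib_left mult.assoc)
  \<comment> \<open>Cauchy-Schwarz over the components \<open>u\<close> reassembles the bounds of
    the individual copies of \<open>M\<close>.\<close>
  also have "\<dots> \<le> op_matrix_norm k M * (L2_set (\<lambda>u. L2_set (\<lambda>j. norm (\<xi> u v j)) {..<k}) S
       * L2_set (\<lambda>u. L2_set (\<lambda>i. norm (\<xi> u w i)) {..<k}) S)"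
    by (intro mult_left_mono L2_set_mult_ineq op_matrix_norm_nonneg)
  also have "\<dots> = op_matrix_norm k M * sqrt (\<Sum>j<k. \<Sum>s\<in>F. Re (B (v s j) (v s j)))
        * sqrt (\<Sum>i<k. \<Sum>t\<in>F. Re (B (w t i) (w t i)))"
    using norm_\<xi>[of v] norm_\<xi>[of w] vS wS by (simp add: L2_set_def[of _ S] mult.assoc)
  finally show ?thesis .
qed

text \<open>The operator is written down on coefficients: the entry at \<open>s i\<close> is the old
  entry at \<open>i\<close> times its weight, and entries off the range of \<open>s\<close> are 0.
  Injectivity of \<open>s\<close> makes this well defined, and the bound on the weights bounds its
  norm by \<open>C\<close>.\<close>

lemma weighted_shift_exists:
  fixes s :: "'i \<Rightarrow> 'i" and w :: "'i \<Rightarrow> real"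
  assumes s: "inj s" and w: "\<And>i. \<bar>w i\<bar> \<le> C"
  shows "\<exists>A\<in>bounded_ops. \<forall>i. blinfun_apply A (ell2_basis i) = w i *\<^sub>R ell2_basis (s i)"
proof -
  define g where "g x j = (if j \<in> range s then of_real (w (inv s j)) * ell2_coeff x (inv s j) else 0)"
    for x :: "'i ell2" and j
  have gs: "g x (s i) = of_real (w i) * ell2_coeff x i" for x i
    by (simp add: g_def inv_f_f[OF s])
  have g0: "j \<notin> range s \<Longrightarrow> g x j = 0" for x j
    by (simp add: g_def)
  have C: "0 \<le> C" using w[of undefined] by linarith
  have le: "(cmod (g x (s i)))\<^sup>2 \<le> C\<^sup>2 * (cmod (ell2_coeff x i))\<^sup>2" for x i
    unfolding gs norm_mult power_mult_distrib
    using w[of i] C by (intro mult_right_mono power_mono) auto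
  have sumC: "(\<lambda>i. C\<^sup>2 * (cmod (ell2_coeff x i))\<^sup>2) summable_on UNIV" for x :: "'i ell2"
    by (intro summable_on_cmult_right ell2_coeff_summable)
  have sum': "(\<lambda>i. (cmod (g x (s i)))\<^sup>2) summable_on UNIV" for x
    by (rule summable_on_comparison_test[OF sumC le]) simp
  have summ: "(\<lambda>j. (cmod (g x j))\<^sup>2) summable_on UNIV" for x
  proof -
    have "(\<lambda>j. (cmod (g x j))\<^sup>2) summable_on range s"
      using sum' by (subst summable_on_reindex[OF s]) (simp add: o_def)
    then show ?thesis
      by (rule summable_on_cong_neutral[THEN iffD1, rotated -1]) (auto simp: g0)
  qed
  define A where "A x = Abs_ell2 (g x)" for x
  have cA: "ell2_coeff (A x) = g x" for x
    unfolding A_def by (rule Abs_ell2_inverse) (use summ in simp)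
  have normA: "norm (A x) \<le> C * norm x" for x
  proof (rule power2_le_imp_le)
    have "(norm (A x))\<^sup>2 = (\<Sum>\<^sub>\<infinity>j\<in>range s. (cmod (g x j))\<^sup>2)"
      unfolding ell2_norm_square cA by (rule infsum_cong_neutral) (auto simp: g0)
    also have "\<dots> = (\<Sum>\<^sub>\<infinity>i. (cmod (g x (s i)))\<^sup>2)"
      by (subst infsum_reindex[OF s]) (simp add: o_def)
    also have "\<dots> \<le> (\<Sum>\<^sub>\<infinity>i. C\<^sup>2 * (cmod (ell2_coeff x i))\<^sup>2)"
      by (intro infsum_mono sum' sumC le)
    also have "\<dots> = (C * norm x)\<^sup>2"
      by (simp add: infsum_cmult_right ell2_coeff_summable ell2_norm_square power_mult_distrib)
    finally show "(norm (A x))\<^sup>2 \<le> (C * norm x)\<^sup>2" .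
  qed (simp add: C)
  have lin: "bounded_linear A"
  proof (rule bounded_linear_intro[where K = C])
    show "A (x + y) = A x + A y" for x y
      by (simp add: ell2_coeff_inject[symmetric] cA plus_ell2.rep_eq fun_eq_iff g_def algebra_simps)
    show "A (r *\<^sub>R x) = r *\<^sub>R A x" for r x
      by (simp add: ell2_coeff_inject[symmetric] cA scaleR_ell2.rep_eq fun_eq_iff g_def)
  qed (use normA in \<open>simp add: mult.commute\<close>)
  show ?thesis
  proof (intro bexI allI)
    fix i
    show "blinfun_apply (Blinfun A) (ell2_basis i) = w i *\<^sub>R ell2_basis (s i)"
      using s by (auto simp: bounded_linear_Blinfun_apply[OF lin] ell2_coeff_inject[symmetric] cA
          scaleR_ell2.rep_eq fun_eq_iff g_def ell2_coeff_basis inv_f_f)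
    show "Blinfun A \<in> bounded_ops"
      by (simp add: bounded_ops_def bounded_linear_Blinfun_apply[OF lin] ell2_coeff_inject[symmetric] cA
          scaleC_ell2.rep_eq fun_eq_iff g_def)
  qed
qed

section \<open>Words in a tuple of operators, and forms given by positive operators\<close>

lemma word_op_bounded_ops:
  "(\<And>i. X $ i \<in> bounded_ops) \<Longrightarrow> word_op X \<alpha> \<in> bounded_ops"
  by (induction \<alpha>) (simp_all add: bounded_ops_compose)

lemma word_op_append: "word_op X (\<alpha> @ \<beta>) = word_op X \<alpha> o\<^sub>L word_op X \<beta>"
  by (induction \<alpha>) (simp_all add: blinfun_eqI)

lemma adj_word_op_append:
  "(\<And>i. X $ i \<in> bounded_ops) \<Longrightarrow>
    blinfun_apply (adj (word_op X (\<alpha> @ \<beta>))) x = blinfun_apply (adj (word_op X \<beta>)) (blinfun_apply (adj (word_op X \<alpha>)) x)"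
  by (simp add: word_op_append adj_compose word_op_bounded_ops)

text \<open>Only conjugate symmetry needs an argument, and it follows by polarization from the
  reality of the diagonal.\<close>

lemma psd_form_positive_op:
  assumes "positive_op D"
  shows "psd_form (\<lambda>x y. cinner (blinfun_apply D x) y)"
  unfolding psd_form_def
proof (intro conjI allI)
  have D: "D \<in> bounded_ops" and real: "\<And>x. Im (cinner (blinfun_apply D x) x) = 0"
    using assms by (simp_all add: positive_op_def)
  \<comment> \<open>Reality at \<open>x + y\<close> relates the imaginary parts of the two mixed
    terms. Replacing \<open>x\<close> by \<open>\<i> *\<^sub>C x\<close> below relates their real
    parts.\<close>
  have sum: "Im (cinner (blinfun_apply D x) y) + Im (cinner (blinfun_apply D y) x) = 0" for x y
    using real[of "x + y"] real[of x] real[of y]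
    by (simp add: blinfun.add_right cinner_add_left cinner_add_right)
  fix x y
  show "cinner (blinfun_apply D y) x = cnj (cinner (blinfun_apply D x) y)"
    using sum[of x y] sum[of "\<i> *\<^sub>C x" y]
    by (simp add: complex_eq_iff bounded_opsD[OF D] cinner_scaleC_left cinner_scaleC_right)
qed (use assms in \<open>simp_all add: positive_op_def blinfun.add_right cinner_add_left
    bounded_opsD cinner_scaleC_left\<close>)

section \<open>Action of the universal model on the basis\<close>

context
  fixes b :: "'n::finite list \<Rightarrow> real"
  assumes adm: "admissible b"
begin

lemma admissible_pos: "0 < b \<alpha>"
  using adm by (simp add: admissible_def)

text \<open>The boundedness of the quotients in \<open>admissible\<close> bounds the weights, so a
  weighted shift with these values exists; it is unique because the basis determines it. Hence the
  description in \<open>weighted_creation\<close> denotes it.\<close>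

lemma weighted_creation:
  "weighted_creation b i \<in> bounded_ops \<and>
     (\<forall>\<alpha>. blinfun_apply (weighted_creation b i) (ell2_basis \<alpha>) = sqrt (b \<alpha> / b (i # \<alpha>)) *\<^sub>R ell2_basis (i # \<alpha>))"
proof -
  obtain C where C: "\<And>\<alpha>. b \<alpha> / b (i # \<alpha>) \<le> C"
    using adm by (force simp: admissible_def bdd_above_def)
  have "\<bar>sqrt (b \<alpha> / b (i # \<alpha>))\<bar> \<le> sqrt C" for \<alpha>
    using admissible_pos[of \<alpha>] admissible_pos[of "i # \<alpha>"] C[of \<alpha>] by simp
  then obtain A where A: "A \<in> bounded_ops"
    "\<And>\<alpha>. blinfun_apply A (ell2_basis \<alpha>) = sqrt (b \<alpha> / b (i # \<alpha>)) *\<^sub>R ell2_basis (i # \<alpha>)"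
    using weighted_shift_exists[of "\<lambda>\<alpha>. i # \<alpha>" "\<lambda>\<alpha>. sqrt (b \<alpha> / b (i # \<alpha>))" "sqrt C"]
    by (auto simp: inj_def)
  show ?thesis
    unfolding weighted_creation_def
    by (rule theI[of _ A]) (use A in \<open>auto intro: bounded_ops_ell2_eqI\<close>)
qed

lemma universal_model_bounded_ops: "universal_model b $ i \<in> bounded_ops"
  by (simp add: universal_model_def weighted_creation)

text \<open>The weights telescope along the word, leaving one quotient under the square
  root.\<close>

lemma word_op_universal_model:
  "blinfun_apply (word_op (universal_model b) \<alpha>) (ell2_basis \<gamma>) = sqrt (b \<gamma> / b (\<alpha> @ \<gamma>)) *\<^sub>R ell2_basis (\<alpha> @ \<gamma>)"
proof (induction \<alpha>)
  case Nil
  then show ?case using admissible_pos[of \<gamma>] by simp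
next
  case (Cons i \<alpha>)
  then show ?case
    using admissible_pos[of "\<alpha> @ \<gamma>"]
    by (simp add: universal_model_def weighted_creation blinfun.scaleR_right real_sqrt_mult[symmetric])
qed

lemma adj_word_op_universal_model:
  "blinfun_apply (adj (word_op (universal_model b) \<alpha>)) (ell2_basis (\<alpha> @ \<gamma>)) = sqrt (b \<gamma> / b (\<alpha> @ \<gamma>)) *\<^sub>R ell2_basis \<gamma>"
  by (rule ell2_eqI)
    (simp add: cinner_adj_left word_op_bounded_ops universal_model_bounded_ops word_op_universal_model
      cinner_scaleR_left cinner_scaleR_right cinner_ell2_basis)

lemma adj_word_op_universal_model_zero:
  "(\<And>\<gamma>. \<sigma> \<noteq> \<alpha> @ \<gamma>) \<Longrightarrow> blinfun_apply (adj (word_op (universal_model b) \<alpha>)) (ell2_basis \<sigma>) = 0"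
  by (rule ell2_eqI)
    (simp add: cinner_adj_left word_op_bounded_ops universal_model_bounded_ops word_op_universal_model
      cinner_scaleR_right cinner_ell2_basis)

text \<open>The adjoints of W_\<beta> and W_\<alpha> strip the prefixes \<beta> and \<alpha> from
  the two basis words, or annihilate the vector. By orthogonality only pairs with the same remaining
  word \<open>\<gamma>\<close> contribute, so the double sum becomes a single sum over
  \<open>\<gamma>\<close>.\<close>

lemma universal_model_kernel_sum:
  assumes F: "finite F"
  shows "(\<Sum>\<sigma>\<in>F. \<Sum>\<tau>\<in>F. cinner (blinfun_apply (word_op (universal_model b) \<alpha> o\<^sub>L
            adj (word_op (universal_model b) \<beta>)) (ell2_basis \<sigma>)) (ell2_basis \<tau>) * h \<sigma> \<tau>)
     = (\<Sum>\<gamma> | \<alpha> @ \<gamma> \<in> F \<and> \<beta> @ \<gamma> \<in> F.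
          of_real (sqrt (b \<gamma> / b (\<alpha> @ \<gamma>)) * sqrt (b \<gamma> / b (\<beta> @ \<gamma>))) * h (\<beta> @ \<gamma>) (\<alpha> @ \<gamma>))"
proof -
  let ?W = "universal_model b"
  define G where "G = {\<gamma>. \<alpha> @ \<gamma> \<in> F \<and> \<beta> @ \<gamma> \<in> F}"
  define c where "c \<sigma> \<tau> = cinner (blinfun_apply (adj (word_op ?W \<beta>)) (ell2_basis \<sigma>))
      (blinfun_apply (adj (word_op ?W \<alpha>)) (ell2_basis \<tau>))" for \<sigma> \<tau>
  have c: "cinner (blinfun_apply (word_op ?W \<alpha> o\<^sub>L adj (word_op ?W \<beta>)) (ell2_basis \<sigma>)) (ell2_basis \<tau>) = c \<sigma> \<tau>" for \<sigma> \<tau>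
    by (simp add: c_def cinner_adj_right word_op_bounded_ops universal_model_bounded_ops)
  have c0: "c \<sigma> \<tau> = 0" if "\<sigma> \<in> F" "\<tau> \<in> F" "(\<sigma>, \<tau>) \<notin> (\<lambda>\<gamma>. (\<beta> @ \<gamma>, \<alpha> @ \<gamma>)) ` G" for \<sigma> \<tau>
  proof (rule ccontr)
    assume nz: "c \<sigma> \<tau> \<noteq> 0"
    then obtain \<gamma> \<gamma>' where *: "\<sigma> = \<beta> @ \<gamma>" "\<tau> = \<alpha> @ \<gamma>'"
      unfolding c_def using adj_word_op_universal_model_zero cinner_zero_left cinner_zero_right by metis
    with nz have "\<gamma> = \<gamma>'"
      by (auto simp: c_def adj_word_op_universal_model cinner_scaleR_left cinner_scaleR_right
          cinner_ell2_basis split: if_splits)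
    with * that show False by (auto simp: G_def)
  qed
  have "(\<Sum>\<sigma>\<in>F. \<Sum>\<tau>\<in>F. c \<sigma> \<tau> * h \<sigma> \<tau>) = (\<Sum>(\<sigma>, \<tau>)\<in>F \<times> F. c \<sigma> \<tau> * h \<sigma> \<tau>)"
    by (simp add: sum.cartesian_product)
  also have "\<dots> = (\<Sum>(\<sigma>, \<tau>)\<in>(\<lambda>\<gamma>. (\<beta> @ \<gamma>, \<alpha> @ \<gamma>)) ` G. c \<sigma> \<tau> * h \<sigma> \<tau>)"
    by (rule sum.mono_neutral_right) (use F c0 in \<open>auto simp: G_def\<close>)
  also have "\<dots> = (\<Sum>\<gamma>\<in>G. c (\<beta> @ \<gamma>) (\<alpha> @ \<gamma>) * h (\<beta> @ \<gamma>) (\<alpha> @ \<gamma>))"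
    by (subst sum.reindex) (auto simp: inj_on_def)
  also have "\<dots> = (\<Sum>\<gamma>\<in>G. of_real (sqrt (b \<gamma> / b (\<alpha> @ \<gamma>)) * sqrt (b \<gamma> / b (\<beta> @ \<gamma>))) * h (\<beta> @ \<gamma>) (\<alpha> @ \<gamma>))"
    by (simp add: c_def adj_word_op_universal_model cinner_scaleR_left cinner_scaleR_right
          cinner_ell2_basis)
  finally show ?thesis unfolding c G_def .
qed

end

section \<open>Pure tuples\<close>

text \<open>The word set \<open>S\<close> is arbitrary so that two cases are covered: all words up
  to a given length, and polynomials, whose coefficients are supported on
  \<open>\<beta> = []\<close>.\<close>

definition nc_kernel ::
    "'n::finite list set \<Rightarrow> ('n list \<Rightarrow> 'n list \<Rightarrow> complex) \<Rightarrow> ('a::chilbert_space \<Rightarrow>\<^sub>L 'a) ^ 'n \<Rightarrow> ('a \<Rightarrow>\<^sub>L 'a)" where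
  "nc_kernel S d X = (\<Sum>\<alpha>\<in>S. \<Sum>\<beta>\<in>S. d \<alpha> \<beta> *\<^sub>C (word_op X \<alpha> o\<^sub>L adj (word_op X \<beta>)))"

lemma nc_kernel_bounded_ops: "(\<And>i. X $ i \<in> bounded_ops) \<Longrightarrow> nc_kernel S d X \<in> bounded_ops"
  unfolding nc_kernel_def
  by (intro bounded_ops_sum bounded_ops_scaleC bounded_ops_compose adj_bounded_ops word_op_bounded_ops)

lemma cinner_nc_kernel:
  "cinner (blinfun_apply (nc_kernel S d X) x) y =
     (\<Sum>\<alpha>\<in>S. \<Sum>\<beta>\<in>S. d \<alpha> \<beta> * cinner (blinfun_apply (word_op X \<alpha> o\<^sub>L adj (word_op X \<beta>)) x) y)"
  by (simp add: nc_kernel_def blinfun.sum_left cinner_sum_left scaleC_blinfun.rep_eq cinner_scaleC_left)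

section \<open>The Berezin kernel of a pure tuple and the resulting inequality\<close>

context
  fixes b :: "'n::finite list \<Rightarrow> real" and T :: "('h::chilbert_space \<Rightarrow>\<^sub>L 'h) ^ 'n"
  assumes adm: "admissible b" and pure: "T \<in> pure_nc_domain b"
begin

private definition B :: "'h \<Rightarrow> 'h \<Rightarrow> complex" where
  "B x y = cinner (blinfun_apply (defect b T) x) y"

text \<open>The noncommutative Berezin kernel sends \<open>x\<close> to the sum over \<sigma> of the
  tensors of \<open>ell2_basis \<sigma>\<close> with the square root of the defect operator applied
  to \<open>v \<sigma> x\<close>. Pairing the vectors \<open>v \<sigma> x\<close> by
  \<open>B\<close> absorbs that square root.\<close>

private definition v :: "'n list \<Rightarrow> 'h \<Rightarrow> 'h" where
  "v \<sigma> x = sqrt (b \<sigma>) *\<^sub>R blinfun_apply (adj (word_op T \<sigma>)) x"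

private lemma T_bounded: "T $ i \<in> bounded_ops"
  using pure by (simp add: pure_nc_domain_def nc_domain_def)

private lemma psd_B: "psd_form B"
  using pure psd_form_positive_op[of "defect b T"]
  by (simp add: B_def[abs_def] pure_nc_domain_def nc_domain_def)

private lemma B_scaleR: "B (r *\<^sub>R x) (s *\<^sub>R y) = of_real (r * s) * B x y"
  by (simp add: scaleR_scaleC psd_form_scaleC_left[OF psd_B] psd_form_scaleC_right[OF psd_B])

text \<open>In terms of the Berezin kernel, purity says that it preserves inner products; here this
  is read off the weak convergence to the identity.\<close>

private lemma purity:
  "((\<lambda>F. \<Sum>\<gamma>\<in>F. of_real (b \<gamma>) * B (blinfun_apply (adj (word_op T \<gamma>)) x) (blinfun_apply (adj (word_op T \<gamma>)) y))
      \<longlongrightarrow> cinner x y) (finite_subsets_at_top UNIV)"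
proof -
  have "((\<lambda>F. cinner (blinfun_apply (\<Sum>\<gamma>\<in>F. b \<gamma> *\<^sub>R (word_op T \<gamma> o\<^sub>L defect b T o\<^sub>L adj (word_op T \<gamma>))) x) y)
      \<longlongrightarrow> cinner (blinfun_apply id_blinfun x) y) (finite_subsets_at_top UNIV)"
    using pure unfolding pure_nc_domain_def defect_sum_is_def wot_tendsto_def by blast
  then show ?thesis
    by (simp add: blinfun.sum_left cinner_sum_left blinfun.scaleR_left cinner_scaleR_left B_def
        cinner_adj_right word_op_bounded_ops T_bounded)
qed

text \<open>A Bessel inequality: the terms are nonnegative and by purity sum to the squared norm, so
  every finite partial sum lies below it.\<close>

private lemma sum_B_v_le:
  assumes F: "finite F"
  shows "(\<Sum>\<sigma>\<in>F. Re (B (v \<sigma> x) (v \<sigma> x))) \<le> (norm x)\<^sup>2"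
proof (rule tendsto_lowerbound)
  have eq: "Re (B (v \<sigma> x) (v \<sigma> x))
      = Re (of_real (b \<sigma>) * B (blinfun_apply (adj (word_op T \<sigma>)) x) (blinfun_apply (adj (word_op T \<sigma>)) x))" for \<sigma>
    using admissible_pos[OF adm, of \<sigma>] by (simp add: v_def B_scaleR)
  show "((\<lambda>F. \<Sum>\<sigma>\<in>F. Re (B (v \<sigma> x) (v \<sigma> x))) \<longlongrightarrow> (norm x)\<^sup>2) (finite_subsets_at_top UNIV)"
    using tendsto_Re[OF purity[of x x]] unfolding eq by (simp add: cinner_self)
  show "\<forall>\<^sub>F F' in finite_subsets_at_top UNIV.
      (\<Sum>\<sigma>\<in>F. Re (B (v \<sigma> x) (v \<sigma> x))) \<le> (\<Sum>\<sigma>\<in>F'. Re (B (v \<sigma> x) (v \<sigma> x)))"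
    unfolding eventually_finite_subsets_at_top
    by (rule exI[of _ F]) (auto intro!: sum_mono2 psd_form_nonneg[OF psd_B] F)
qed simp

text \<open>Compressing the ampliation of W_\<alpha> times the adjoint of W_\<beta> by the Berezin
  kernel gives the same word expression in \<open>T\<close>. After the reduction to one sum over
  \<open>\<gamma>\<close>, the adjoints of T_\<beta> and T_\<alpha> are applied to \<open>x\<close>
  and \<open>y\<close> first, and the claim is purity at these two vectors.\<close>

private lemma kernel_sum_tendsto:
  "((\<lambda>F. \<Sum>\<sigma>\<in>F. \<Sum>\<tau>\<in>F. cinner (blinfun_apply (word_op (universal_model b) \<alpha> o\<^sub>L
            adj (word_op (universal_model b) \<beta>)) (ell2_basis \<sigma>)) (ell2_basis \<tau>) * B (v \<sigma> x) (v \<tau> y))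
      \<longlongrightarrow> cinner (blinfun_apply (word_op T \<alpha> o\<^sub>L adj (word_op T \<beta>)) x) y) (finite_subsets_at_top UNIV)"
proof -
  let ?G = "\<lambda>F. {\<gamma>. \<alpha> @ \<gamma> \<in> F \<and> \<beta> @ \<gamma> \<in> F}"
  let ?x = "blinfun_apply (adj (word_op T \<beta>)) x" and ?y = "blinfun_apply (adj (word_op T \<alpha>)) y"
  let ?f = "\<lambda>\<gamma>. of_real (b \<gamma>) * B (blinfun_apply (adj (word_op T \<gamma>)) ?x) (blinfun_apply (adj (word_op T \<gamma>)) ?y)"
  \<comment> \<open>The square roots contributed by \<open>v\<close> cancel the denominators of the
    universal model, so exactly the weight \<open>b \<gamma>\<close> of the purity sum
    remains.\<close>
  have term_eq: "of_real (sqrt (b \<gamma> / b (\<alpha> @ \<gamma>)) * sqrt (b \<gamma> / b (\<beta> @ \<gamma>))) * B (v (\<beta> @ \<gamma>) x) (v (\<alpha> @ \<gamma>) y) = ?f \<gamma>" for \<gamma>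
  proof -
    have pos: "0 < b \<gamma>" "0 < b (\<alpha> @ \<gamma>)" "0 < b (\<beta> @ \<gamma>)" by (rule admissible_pos[OF adm])+
    have "sqrt (b \<gamma> / b (\<alpha> @ \<gamma>)) * sqrt (b \<gamma> / b (\<beta> @ \<gamma>)) * (sqrt (b (\<beta> @ \<gamma>)) * sqrt (b (\<alpha> @ \<gamma>))) = b \<gamma>"
      using pos by (simp add: real_sqrt_divide)
    then have "complex_of_real (b \<gamma>) = of_real (sqrt (b \<gamma> / b (\<alpha> @ \<gamma>)) * sqrt (b \<gamma> / b (\<beta> @ \<gamma>)))
        * of_real (sqrt (b (\<beta> @ \<gamma>)) * sqrt (b (\<alpha> @ \<gamma>)))"
      by (simp only: of_real_mult[symmetric])
    then show ?thesis
      by (simp only: v_def B_scaleR adj_word_op_append T_bounded mult.assoc)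
  qed
  \<comment> \<open>Truncating the basis words to \<open>F\<close> truncates \<open>\<gamma>\<close>
    to \<open>?G F\<close>. This set contains any prescribed finite \<open>X\<close> as soon as
    \<open>F\<close> contains \<open>X\<close> prefixed by \<open>\<alpha>\<close> and by
    \<open>\<beta>\<close>, so the purity limit may be taken along \<open>?G\<close>.\<close>
  have lim: "filterlim ?G (finite_subsets_at_top UNIV) (finite_subsets_at_top UNIV)"
    unfolding filterlim_iff
  proof (intro allI impI)
    fix P assume "eventually P (finite_subsets_at_top (UNIV :: 'n list set))"
    then obtain X where X: "finite X" "\<And>Y. finite Y \<Longrightarrow> X \<subseteq> Y \<Longrightarrow> P Y"
      by (auto simp: eventually_finite_subsets_at_top)
    show "\<forall>\<^sub>F F in finite_subsets_at_top UNIV. P (?G F)"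
      unfolding eventually_finite_subsets_at_top
    proof (intro exI conjI allI impI)
      show "finite ((@) \<alpha> ` X \<union> (@) \<beta> ` X)" using X by simp
      fix F assume F: "finite F \<and> (@) \<alpha> ` X \<union> (@) \<beta> ` X \<subseteq> F \<and> F \<subseteq> UNIV"
      have "finite ((@) \<alpha> -` F)"
        using F by (intro finite_vimageI) (auto simp: inj_on_def)
      then show "P (?G F)"
        using F by (intro X(2)) (auto intro: finite_subset[of _ "(@) \<alpha> -` F"])
    qed simp
  qed
  have "((\<lambda>F. sum ?f (?G F)) \<longlongrightarrow> cinner ?x ?y) (finite_subsets_at_top UNIV)"
    by (rule filterlim_compose[OF purity lim])
  moreover have "\<forall>\<^sub>F F in finite_subsets_at_top UNIV. sum ?f (?G F) =
      (\<Sum>\<sigma>\<in>F. \<Sum>\<tau>\<in>F. cinner (blinfun_apply (word_op (universal_model b) \<alpha> o\<^sub>L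
            adj (word_op (universal_model b) \<beta>)) (ell2_basis \<sigma>)) (ell2_basis \<tau>) * B (v \<sigma> x) (v \<tau> y))"
    by (rule eventually_finite_subsets_at_top_weakI)
       (simp only: universal_model_kernel_sum[OF adm] term_eq)
  ultimately have "((\<lambda>F. \<Sum>\<sigma>\<in>F. \<Sum>\<tau>\<in>F. cinner (blinfun_apply (word_op (universal_model b) \<alpha> o\<^sub>L
            adj (word_op (universal_model b) \<beta>)) (ell2_basis \<sigma>)) (ell2_basis \<tau>) * B (v \<sigma> x) (v \<tau> y))
      \<longlongrightarrow> cinner ?x ?y) (finite_subsets_at_top UNIV)"
    by (rule Lim_transform_eventually)
  then show ?thesis
    by (simp add: cinner_adj_right word_op_bounded_ops T_bounded)
qed

text \<open>For every finite truncation \<open>F\<close> the ampliation bound and the Bessel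
  inequality give an estimate independent of \<open>F\<close>. The truncated forms converge to the
  form of the operator matrix in \<open>T\<close>, so the estimate survives.\<close>

lemma op_matrix_norm_nc_kernel_pure:
  "op_matrix_norm k (\<lambda>i j. nc_kernel S (d i j) T) \<le> op_matrix_norm k (\<lambda>i j. nc_kernel S (d i j) (universal_model b))"
proof (rule op_matrix_norm_le_formI[OF op_matrix_norm_nonneg])
  fix x y :: "nat \<Rightarrow> 'h"
  let ?W = "universal_model b"
  let ?N = "op_matrix_norm k (\<lambda>i j. nc_kernel S (d i j) ?W)"
  let ?Q = "\<lambda>F. \<Sum>i<k. \<Sum>j<k. \<Sum>\<sigma>\<in>F. \<Sum>\<tau>\<in>F.
      cinner (blinfun_apply (nc_kernel S (d i j) ?W) (ell2_basis \<sigma>)) (ell2_basis \<tau>) * B (v \<sigma> (x j)) (v \<tau> (y i))"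
  \<comment> \<open>The word sums are moved outside the truncation, so that the limit can be taken
    separately for each pair \<open>\<alpha>\<close>, \<open>\<beta>\<close>.\<close>
  have Q: "?Q F = (\<Sum>i<k. \<Sum>j<k. \<Sum>\<alpha>\<in>S. \<Sum>\<beta>\<in>S. d i j \<alpha> \<beta> *
      (\<Sum>\<sigma>\<in>F. \<Sum>\<tau>\<in>F. cinner (blinfun_apply (word_op ?W \<alpha> o\<^sub>L adj (word_op ?W \<beta>)) (ell2_basis \<sigma>)) (ell2_basis \<tau>)
          * B (v \<sigma> (x j)) (v \<tau> (y i))))" for F
  proof (rule sum.cong[OF refl], rule sum.cong[OF refl])
    fix i j
    let ?c = "\<lambda>\<alpha> \<beta> \<sigma> \<tau>. d i j \<alpha> \<beta> * (cinner (blinfun_apply (word_op ?W \<alpha> o\<^sub>L adj (word_op ?W \<beta>)) (ell2_basis \<sigma>)) (ell2_basis \<tau>)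
          * B (v \<sigma> (x j)) (v \<tau> (y i)))"
    have "(\<Sum>\<sigma>\<in>F. \<Sum>\<tau>\<in>F. cinner (blinfun_apply (nc_kernel S (d i j) ?W) (ell2_basis \<sigma>)) (ell2_basis \<tau>) * B (v \<sigma> (x j)) (v \<tau> (y i)))
        = (\<Sum>\<sigma>\<in>F. \<Sum>\<tau>\<in>F. \<Sum>\<alpha>\<in>S. \<Sum>\<beta>\<in>S. ?c \<alpha> \<beta> \<sigma> \<tau>)"
      by (simp only: cinner_nc_kernel sum_distrib_right mult.assoc)
    also have "\<dots> = (\<Sum>\<alpha>\<in>S. \<Sum>\<sigma>\<in>F. \<Sum>\<tau>\<in>F. \<Sum>\<beta>\<in>S. ?c \<alpha> \<beta> \<sigma> \<tau>)"
      by (rule trans[OF sum.cong[OF refl sum.swap] sum.swap])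
    also have "\<dots> = (\<Sum>\<alpha>\<in>S. \<Sum>\<beta>\<in>S. \<Sum>\<sigma>\<in>F. \<Sum>\<tau>\<in>F. ?c \<alpha> \<beta> \<sigma> \<tau>)"
      by (rule sum.cong[OF refl trans[OF sum.cong[OF refl sum.swap] sum.swap]])
    finally show "(\<Sum>\<sigma>\<in>F. \<Sum>\<tau>\<in>F. cinner (blinfun_apply (nc_kernel S (d i j) ?W) (ell2_basis \<sigma>)) (ell2_basis \<tau>) * B (v \<sigma> (x j)) (v \<tau> (y i)))
        = (\<Sum>\<alpha>\<in>S. \<Sum>\<beta>\<in>S. d i j \<alpha> \<beta> * (\<Sum>\<sigma>\<in>F. \<Sum>\<tau>\<in>F. cinner (blinfun_apply (word_op ?W \<alpha> o\<^sub>L adj (word_op ?W \<beta>)) (ell2_basis \<sigma>)) (ell2_basis \<tau>)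
          * B (v \<sigma> (x j)) (v \<tau> (y i))))"
      by (simp only: sum_distrib_left)
  qed
  have lim: "(?Q \<longlongrightarrow> (\<Sum>i<k. \<Sum>j<k. cinner (blinfun_apply (nc_kernel S (d i j) T) (x j)) (y i))) (finite_subsets_at_top UNIV)"
    unfolding Q unfolding cinner_nc_kernel by (intro tendsto_sum tendsto_mult_left kernel_sum_tendsto)
  show "cmod (\<Sum>i<k. \<Sum>j<k. cinner (blinfun_apply (nc_kernel S (d i j) T) (x j)) (y i))
      \<le> ?N * L2_set (\<lambda>j. norm (x j)) {..<k} * L2_set (\<lambda>i. norm (y i)) {..<k}"
  proof (rule tendsto_upperbound[OF tendsto_norm[OF lim]])
    show "\<forall>\<^sub>F F in finite_subsets_at_top UNIV.
       cmod (?Q F) \<le> ?N * L2_set (\<lambda>j. norm (x j)) {..<k} * L2_set (\<lambda>i. norm (y i)) {..<k}"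
    proof (rule eventually_finite_subsets_at_top_weakI)
      fix F :: "'n list set" assume F: "finite F"
      have le: "sqrt (\<Sum>j<k. \<Sum>\<sigma>\<in>F. Re (B (v \<sigma> (z j)) (v \<sigma> (z j)))) \<le> L2_set (\<lambda>j. norm (z j)) {..<k}" for z
        unfolding L2_set_def by (intro real_sqrt_le_mono sum_mono sum_B_v_le F)
      have "cmod (?Q F) \<le> ?N * sqrt (\<Sum>j<k. \<Sum>\<sigma>\<in>F. Re (B (v \<sigma> (x j)) (v \<sigma> (x j))))
          * sqrt (\<Sum>i<k. \<Sum>\<tau>\<in>F. Re (B (v \<tau> (y i)) (v \<tau> (y i))))"
        by (rule ell2_ampliation_bound[OF F psd_B])
          (intro nc_kernel_bounded_ops universal_model_bounded_ops adm)
      also have "\<dots> \<le> ?N * L2_set (\<lambda>j. norm (x j)) {..<k} * L2_set (\<lambda>i. norm (y i)) {..<k}"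
        by (intro mult_mono le mult_left_mono mult_nonneg_nonneg op_matrix_norm_nonneg L2_set_nonneg
            real_sqrt_ge_zero sum_nonneg psd_form_nonneg[OF psd_B])
      finally show "cmod (?Q F) \<le> ?N * L2_set (\<lambda>j. norm (x j)) {..<k} * L2_set (\<lambda>i. norm (y i)) {..<k}" .
    qed
  qed simp
qed

end

section \<open>Norm limits and polynomials\<close>

lemma scaleC_zero_left [simp]: "0 *\<^sub>C (x::'a::complex_vector) = 0"
  using scaleC_add_left[of 0 0 x] by simp

lemma compose_id_blinfun [simp]: "A o\<^sub>L id_blinfun = A"
  by (rule blinfun_eqI) simp

text \<open>Entries outside the \<open>k\<close> by \<open>k\<close> block may differ; the
  perturbation estimate has error 0 in both directions.\<close>

lemma op_matrix_norm_cong: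
  assumes "\<And>i j. i < k \<Longrightarrow> j < k \<Longrightarrow> M i j = N i j"
  shows "op_matrix_norm k M = op_matrix_norm k N"
  using op_matrix_norm_perturb[of k M N] op_matrix_norm_perturb[of k N M] assms by simp

lemma tendsto_blinfun_compose:
  "(f \<longlongrightarrow> A) F \<Longrightarrow> (g \<longlongrightarrow> B) F \<Longrightarrow> ((\<lambda>n. f n o\<^sub>L g n) \<longlongrightarrow> A o\<^sub>L B) F"
  by (rule bounded_bilinear.tendsto[OF bounded_bilinear_blinfun_compose])

lemma tendsto_scaleC_blinfun:
  fixes A :: "'a::real_normed_vector \<Rightarrow>\<^sub>L 'b::chilbert_space"
  shows "(f \<longlongrightarrow> A) F \<Longrightarrow> ((\<lambda>n. c *\<^sub>C f n) \<longlongrightarrow> c *\<^sub>C A) F"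
  by (rule bounded_linear.tendsto[OF bounded_linear_scaleC_blinfun])

lemma tendsto_word_op:
  assumes "X \<longlonglongrightarrow> T"
  shows "(\<lambda>n. word_op (X n) \<alpha>) \<longlonglongrightarrow> word_op T \<alpha>"
  by (induction \<alpha>) (simp_all add: tendsto_blinfun_compose tendsto_vec_nth[OF assms])

lemma tendsto_nc_kernel:
  assumes "\<And>n i. X n $ i \<in> bounded_ops" and "X \<longlonglongrightarrow> T"
  shows "(\<lambda>n. nc_kernel S d (X n)) \<longlonglongrightarrow> nc_kernel S d T"
  unfolding nc_kernel_def
  by (intro tendsto_sum tendsto_scaleC_blinfun tendsto_blinfun_compose tendsto_adj tendsto_word_op
      word_op_bounded_ops assms)

text \<open>A point of the closure is a norm limit of pure tuples. The kernels depend continuously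
  on the tuple, while the side of the universal model stays constant.\<close>

lemma op_matrix_norm_nc_kernel_le:
  assumes b: "admissible b" and T: "T \<in> closure (pure_nc_domain b)"
  shows "op_matrix_norm k (\<lambda>i j. nc_kernel S (d i j) T)
    \<le> op_matrix_norm k (\<lambda>i j. nc_kernel S (d i j) (universal_model b))"
proof -
  obtain X where X: "\<And>n. X n \<in> pure_nc_domain b" and lim: "X \<longlonglongrightarrow> T"
    using T by (auto simp: closure_sequential)
  have "X n $ i \<in> bounded_ops" for n i
    using X[of n] by (simp add: pure_nc_domain_def nc_domain_def)
  then have "(\<lambda>n. nc_kernel S (d i j) (X n)) \<longlonglongrightarrow> nc_kernel S (d i j) T" for i j
    using lim by (rule tendsto_nc_kernel)
  then show ?thesis
    by (rule op_matrix_norm_limit_le) (use op_matrix_norm_nc_kernel_pure[OF b X] in auto)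
qed

lemma closure_pure_nc_domain_bounded_ops:
  assumes "T \<in> closure (pure_nc_domain b)"
  shows "T $ i \<in> bounded_ops"
proof -
  obtain X where X: "\<And>n. X n \<in> pure_nc_domain b" and lim: "X \<longlonglongrightarrow> T"
    using assms by (auto simp: closure_sequential)
  have "X n $ i \<in> bounded_ops" for n
    using X[of n] by (simp add: pure_nc_domain_def nc_domain_def)
  then show ?thesis by (rule bounded_ops_limit[OF _ tendsto_vec_nth[OF lim]])
qed

section \<open>Evaluation of noncommutative polynomials\<close>

lemma poly_op_superset:
  assumes "finite S" "Poly_Mapping.keys p \<subseteq> S"
  shows "poly_op p X = (\<Sum>\<alpha>\<in>S. Poly_Mapping.lookup p \<alpha> *\<^sub>C word_op X \<alpha>)"
  unfolding poly_op_def using assms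
  by (intro sum.mono_neutral_left) (auto simp: in_keys_iff)

lemma poly_op_add: "poly_op (p + q) X = poly_op p X + poly_op q X"
proof -
  let ?S = "Poly_Mapping.keys p \<union> Poly_Mapping.keys q"
  have "poly_op (p + q) X = (\<Sum>\<alpha>\<in>?S. Poly_Mapping.lookup (p + q) \<alpha> *\<^sub>C word_op X \<alpha>)"
    by (rule poly_op_superset) (simp_all add: keys_add)
  then show ?thesis
    by (simp add: poly_op_superset[of ?S p] poly_op_superset[of ?S q] lookup_add scaleC_add_left
        sum.distrib)
qed

lemma poly_op_single: "poly_op (Poly_Mapping.single \<alpha> c) X = c *\<^sub>C word_op X \<alpha>"
  by (simp add: poly_op_def)

lemma poly_op_sum: "poly_op (\<Sum>i\<in>I. p i) X = (\<Sum>i\<in>I. poly_op (p i) X)"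
  by (induction I rule: infinite_finite_induct) (simp_all add: poly_op_add, simp_all add: poly_op_def)

lemma poly_op_bounded_ops: "(\<And>i. X $ i \<in> bounded_ops) \<Longrightarrow> poly_op p X \<in> bounded_ops"
  unfolding poly_op_def by (intro bounded_ops_sum bounded_ops_scaleC word_op_bounded_ops)

definition poly_scale :: "complex \<Rightarrow> ('n list \<Rightarrow>\<^sub>0 complex) \<Rightarrow> ('n list \<Rightarrow>\<^sub>0 complex)" where
  "poly_scale c p = (\<Sum>\<alpha>\<in>Poly_Mapping.keys p. Poly_Mapping.single \<alpha> (c * Poly_Mapping.lookup p \<alpha>))"

text \<open>This is the product of noncommutative polynomials, with words multiplied by
  concatenation. It is spelled out as a sum of monomials so that evaluation reduces to
  words.\<close>

definition poly_concat :: "('n list \<Rightarrow>\<^sub>0 complex) \<Rightarrow> ('n list \<Rightarrow>\<^sub>0 complex) \<Rightarrow> ('n list \<Rightarrow>\<^sub>0 complex)" where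
  "poly_concat p q = (\<Sum>\<alpha>\<in>Poly_Mapping.keys p. \<Sum>\<beta>\<in>Poly_Mapping.keys q.
     Poly_Mapping.single (\<alpha> @ \<beta>) (Poly_Mapping.lookup p \<alpha> * Poly_Mapping.lookup q \<beta>))"

lemma poly_op_scale: "poly_op (poly_scale c p) X = c *\<^sub>C poly_op p X"
  unfolding poly_scale_def poly_op_sum poly_op_single
  by (simp add: poly_op_def scaleC_sum_right scaleC_scaleC)

lemma poly_op_concat:
  assumes "\<And>i. X $ i \<in> bounded_ops"
  shows "poly_op (poly_concat p q) X = poly_op p X o\<^sub>L poly_op q X"
  unfolding poly_concat_def poly_op_sum poly_op_single poly_op_def[of p]
    bounded_bilinear.sum_left[OF bounded_bilinear_blinfun_compose]
  unfolding poly_op_def bounded_bilinear.sum_right[OF bounded_bilinear_blinfun_compose]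
  by (simp add: word_op_append scaleC_compose_left scaleC_compose_right word_op_bounded_ops assms
      scaleC_scaleC)

text \<open>A polynomial is a kernel whose coefficients vanish unless the second word is empty,
  where the adjoint factor is the identity.\<close>

lemma op_matrix_norm_poly_op_le:
  fixes b :: "'n::finite list \<Rightarrow> real" and T :: "('h::chilbert_space \<Rightarrow>\<^sub>L 'h) ^ 'n"
  assumes b: "admissible b" and T: "T \<in> closure (pure_nc_domain b)"
  shows "op_matrix_norm k (\<lambda>i j. poly_op (p i j) T)
    \<le> op_matrix_norm k (\<lambda>i j. poly_op (p i j) (universal_model b))"
proof -
  \<comment> \<open>One finite word set serves all entries of the matrix; the empty word is added
    since it must be available as the second word.\<close>
  define S where "S = insert [] (\<Union>i<k. \<Union>j<k. Poly_Mapping.keys (p i j))"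
  define d where "d i j \<alpha> \<beta> = (if \<beta> = [] then Poly_Mapping.lookup (p i j) \<alpha> else 0)"
    for i j \<alpha> and \<beta> :: "'n list"
  have S: "finite S" "[] \<in> S" by (simp_all add: S_def)
  have "nc_kernel S (d i j) X = poly_op (p i j) X" if "i < k" "j < k"
    for i j and X :: "('x::chilbert_space \<Rightarrow>\<^sub>L 'x) ^ 'n"
  proof -
    have "(\<Sum>\<beta>\<in>S. d i j \<alpha> \<beta> *\<^sub>C (word_op X \<alpha> o\<^sub>L adj (word_op X \<beta>)))
        = (\<Sum>\<beta>\<in>{[]}. d i j \<alpha> \<beta> *\<^sub>C (word_op X \<alpha> o\<^sub>L adj (word_op X \<beta>)))" for \<alpha>
      using S by (intro sum.mono_neutral_right) (auto simp: d_def)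
    moreover have "Poly_Mapping.keys (p i j) \<subseteq> S" using that by (auto simp: S_def)
    ultimately show ?thesis
      by (simp add: nc_kernel_def d_def poly_op_superset[OF S(1)])
  qed
  then have eq: "op_matrix_norm k (\<lambda>i j. nc_kernel S (d i j) X) = op_matrix_norm k (\<lambda>i j. poly_op (p i j) X)"
    for X :: "('x::chilbert_space \<Rightarrow>\<^sub>L 'x) ^ 'n"
    by (rule op_matrix_norm_cong)
  show ?thesis
    using op_matrix_norm_nc_kernel_le[OF b T, of k S d] unfolding eq .
qed

section \<open>The functional calculus\<close>

context
  fixes b :: "'n::finite list \<Rightarrow> real" and T :: "('h::chilbert_space \<Rightarrow>\<^sub>L 'h) ^ 'n"
  assumes adm: "admissible b" and T: "T \<in> closure (pure_nc_domain b)"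
begin

text \<open>This is the graph of the functional calculus, as the closure of the pairs of values of a
  common polynomial. Working with a relation separates well-definedness from existence and lets the
  algebraic rules be proved along sequences.\<close>

definition calculus_rel :: "('n list ell2 \<Rightarrow>\<^sub>L 'n list ell2) \<Rightarrow> ('h \<Rightarrow>\<^sub>L 'h) \<Rightarrow> bool" where
  "calculus_rel A A' \<longleftrightarrow> (\<exists>p. (\<lambda>n::nat. poly_op (p n) (universal_model b)) \<longlonglongrightarrow> A \<and> (\<lambda>n. poly_op (p n) T) \<longlonglongrightarrow> A')"

text \<open>The 1 by 1 inequality for the polynomial \<open>p - q\<close>. It makes limits in
  \<open>T\<close> independent of the approximating polynomials and carries the Cauchy property from
  the universal model to \<open>T\<close>.\<close>

lemma norm_poly_op_diff_le:
  "norm (poly_op p T - poly_op q T) \<le> norm (poly_op p (universal_model b) - poly_op q (universal_model b))"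
proof -
  have diff: "poly_op (p + poly_scale (- 1) q) X = poly_op p X - poly_op q X"
    for X :: "('a::chilbert_space \<Rightarrow>\<^sub>L 'a) ^ 'n"
    using scaleR_scaleC[of "- 1" "poly_op q X"] by (simp add: poly_op_add poly_op_scale)
  show ?thesis
    using op_matrix_norm_poly_op_le[OF adm T, of 1 "\<lambda>i j. p + poly_scale (- 1) q"]
    by (simp only: op_matrix_norm_1 diff)
qed

lemma calculus_rel_poly: "calculus_rel (poly_op p (universal_model b)) (poly_op p T)"
  unfolding calculus_rel_def by (rule exI[of _ "\<lambda>_. p"]) simp

lemma calculus_rel_unique:
  assumes "calculus_rel A A'" "calculus_rel A A''"
  shows "A' = A''"
proof -
  let ?W = "universal_model b"
  obtain p q where p: "(\<lambda>n. poly_op (p n) ?W) \<longlonglongrightarrow> A" "(\<lambda>n. poly_op (p n) T) \<longlonglongrightarrow> A'"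
    and q: "(\<lambda>n. poly_op (q n) ?W) \<longlonglongrightarrow> A" "(\<lambda>n. poly_op (q n) T) \<longlonglongrightarrow> A''"
    using assms unfolding calculus_rel_def by blast
  have "(\<lambda>n. norm (poly_op (p n) ?W - poly_op (q n) ?W)) \<longlonglongrightarrow> 0"
    using tendsto_norm[OF tendsto_diff[OF p(1) q(1)]] by simp
  then have "(\<lambda>n. poly_op (p n) T - poly_op (q n) T) \<longlonglongrightarrow> 0"
    by (rule Lim_null_comparison[rotated]) (simp add: norm_poly_op_diff_le)
  from LIMSEQ_unique[OF this tendsto_diff[OF p(2) q(2)]] show ?thesis by simp
qed

lemma calculus_rel_exists:
  assumes "A \<in> closure (range (\<lambda>p. poly_op p (universal_model b)))"
  shows "\<exists>A'. calculus_rel A A'"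
proof -
  obtain f where f: "\<forall>n. f n \<in> range (\<lambda>p. poly_op p (universal_model b))" and lim: "f \<longlonglongrightarrow> A"
    using assms unfolding closure_sequential by (elim exE conjE)
  define p where "p n = (SOME p. f n = poly_op p (universal_model b))" for n
  have p: "f n = poly_op (p n) (universal_model b)" for n
    unfolding p_def by (rule someI_ex) (use f in \<open>simp add: image_iff\<close>)
  have le: "dist (poly_op (p m) T) (poly_op (p n) T) \<le> dist (f m) (f n)" for m n
    unfolding dist_norm p by (rule norm_poly_op_diff_le)
  have "Cauchy (\<lambda>n. poly_op (p n) T)"
  proof (rule metric_CauchyI)
    fix e :: real assume "e > 0"
    then obtain M where "\<forall>m\<ge>M. \<forall>n\<ge>M. dist (f m) (f n) < e"
      using metric_CauchyD[OF LIMSEQ_imp_Cauchy[OF lim]] by blast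
    then show "\<exists>M. \<forall>m\<ge>M. \<forall>n\<ge>M. dist (poly_op (p m) T) (poly_op (p n) T) < e"
      using le le_less_trans by blast
  qed
  then obtain A' where "(\<lambda>n. poly_op (p n) T) \<longlonglongrightarrow> A'"
    unfolding Cauchy_convergent_iff convergent_def by (rule exE)
  moreover have "(\<lambda>n. poly_op (p n) (universal_model b)) \<longlonglongrightarrow> A"
    using lim unfolding p[abs_def] .
  ultimately show ?thesis
    unfolding calculus_rel_def by (intro exI conjI)
qed

lemma calculus_rel_add:
  assumes "calculus_rel A A'" "calculus_rel C C'"
  shows "calculus_rel (A + C) (A' + C')"
proof -
  obtain p q where "(\<lambda>n. poly_op (p n) (universal_model b)) \<longlonglongrightarrow> A" "(\<lambda>n. poly_op (p n) T) \<longlonglongrightarrow> A'"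
    "(\<lambda>n. poly_op (q n) (universal_model b)) \<longlonglongrightarrow> C" "(\<lambda>n. poly_op (q n) T) \<longlonglongrightarrow> C'"
    using assms unfolding calculus_rel_def by blast
  then show ?thesis
    unfolding calculus_rel_def
    by (intro exI[of _ "\<lambda>n. p n + q n"]) (simp add: poly_op_add tendsto_add)
qed

lemma calculus_rel_compose:
  assumes "calculus_rel A A'" "calculus_rel C C'"
  shows "calculus_rel (A o\<^sub>L C) (A' o\<^sub>L C')"
proof -
  obtain p q where "(\<lambda>n. poly_op (p n) (universal_model b)) \<longlonglongrightarrow> A" "(\<lambda>n. poly_op (p n) T) \<longlonglongrightarrow> A'"
    "(\<lambda>n. poly_op (q n) (universal_model b)) \<longlonglongrightarrow> C" "(\<lambda>n. poly_op (q n) T) \<longlonglongrightarrow> C'"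
    using assms unfolding calculus_rel_def by blast
  then show ?thesis
    unfolding calculus_rel_def
    by (intro exI[of _ "\<lambda>n. poly_concat (p n) (q n)"])
      (simp add: poly_op_concat universal_model_bounded_ops adm closure_pure_nc_domain_bounded_ops[OF T]
        tendsto_blinfun_compose)
qed

lemma calculus_rel_scaleC:
  assumes "calculus_rel A A'"
  shows "calculus_rel (c *\<^sub>C A) (c *\<^sub>C A')"
proof -
  obtain p where "(\<lambda>n. poly_op (p n) (universal_model b)) \<longlonglongrightarrow> A" "(\<lambda>n. poly_op (p n) T) \<longlonglongrightarrow> A'"
    using assms unfolding calculus_rel_def by blast
  then show ?thesis
    unfolding calculus_rel_def
    by (intro exI[of _ "\<lambda>n. poly_scale c (p n)"]) (simp add: poly_op_scale tendsto_scaleC_blinfun)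
qed

lemma calculus_rel_word: "calculus_rel (word_op (universal_model b) \<alpha>) (word_op T \<alpha>)"
  using calculus_rel_poly[of "Poly_Mapping.single \<alpha> 1"] by (simp add: poly_op_single scaleC_one)

text \<open>The norm closure of the polynomials in the universal model is a closed unital subalgebra
  containing the generators, so it contains the intersection that defines the domain
  algebra.\<close>

lemma calculus_rel_domain_algebra:
  assumes "A \<in> domain_algebra b"
  shows "\<exists>A'. calculus_rel A A'"
proof -
  let ?S = "closure (range (\<lambda>p. poly_op p (universal_model b)))"
  \<comment> \<open>Membership in the closure is the same as having a value under the calculus, so
    closure under the algebra operations follows from the rules for
    \<open>calculus_rel\<close>.\<close>
  have S: "A \<in> ?S \<longleftrightarrow> (\<exists>A'. calculus_rel A A')" for A
  proof
    assume "\<exists>A'. calculus_rel A A'"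
    then show "A \<in> ?S"
      unfolding calculus_rel_def closure_sequential by (elim exE conjE) (intro exI conjI, auto)
  qed (rule calculus_rel_exists)
  have "closed_unital_subalgebra ?S"
    unfolding closed_unital_subalgebra_def
  proof (intro conjI ballI allI)
    show "id_blinfun \<in> ?S"
      unfolding S using calculus_rel_word[of "[]"] by auto
    show "A + C \<in> ?S" "A o\<^sub>L C \<in> ?S" if "A \<in> ?S" "C \<in> ?S" for A C
      using that unfolding S by (meson calculus_rel_add, meson calculus_rel_compose)
    show "c *\<^sub>C A \<in> ?S" if "A \<in> ?S" for c A
      using that unfolding S by (meson calculus_rel_scaleC)
  qed simp
  moreover have "universal_model b $ i \<in> ?S" for i
    unfolding S using calculus_rel_word[of "[i]"] by auto
  ultimately have "domain_algebra b \<subseteq> ?S"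
    unfolding domain_algebra_def by (intro Inter_lower) blast
  then show ?thesis using assms S by blast
qed

lemma functional_calculus_exists:
  "\<exists>\<Psi>. unital_homomorphism_on (domain_algebra b) \<Psi> \<and> completely_contractive_on (domain_algebra b) \<Psi> \<and>
     (\<forall>p. \<Psi> (poly_op p (universal_model b)) = poly_op p T)"
proof -
  \<comment> \<open>By uniqueness this picks the value of the calculus wherever one exists, in
    particular on the domain algebra and at every polynomial in the universal model.\<close>
  define \<Psi> where "\<Psi> A = (THE A'. calculus_rel A A')" for A
  have \<Psi>: "\<Psi> A = A'" if "calculus_rel A A'" for A A'
    unfolding \<Psi>_def using that by (blast intro: the_equality calculus_rel_unique)
  have rel: "calculus_rel A (\<Psi> A)" if "A \<in> domain_algebra b" for A
    using calculus_rel_domain_algebra[OF that] by (metis \<Psi>)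
  have bdd: "A' \<in> bounded_ops" if A: "calculus_rel A A'" for A A'
  proof -
    obtain p where "(\<lambda>n. poly_op (p n) T) \<longlonglongrightarrow> A'"
      using A unfolding calculus_rel_def by blast
    then show ?thesis
      by (rule bounded_ops_limit[rotated])
        (intro poly_op_bounded_ops closure_pure_nc_domain_bounded_ops[OF T])
  qed
  have "unital_homomorphism_on (domain_algebra b) \<Psi>"
    unfolding unital_homomorphism_on_def
  proof (intro conjI ballI allI)
    show "\<Psi> ` domain_algebra b \<subseteq> bounded_ops" by (rule image_subsetI) (rule bdd[OF rel])
    show "\<Psi> id_blinfun = id_blinfun" using \<Psi>[OF calculus_rel_word[of "[]"]] by simp
    fix A C assume A: "A \<in> domain_algebra b" and C: "C \<in> domain_algebra b"
    show "\<Psi> (A + C) = \<Psi> A + \<Psi> C"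
      by (rule \<Psi>[OF calculus_rel_add[OF rel[OF A] rel[OF C]]])
    show "\<Psi> (A o\<^sub>L C) = \<Psi> A o\<^sub>L \<Psi> C"
      by (rule \<Psi>[OF calculus_rel_compose[OF rel[OF A] rel[OF C]]])
  next
    fix c A assume "A \<in> domain_algebra b"
    then show "\<Psi> (c *\<^sub>C A) = c *\<^sub>C \<Psi> A"
      by (intro \<Psi> calculus_rel_scaleC rel)
  qed
  moreover have "completely_contractive_on (domain_algebra b) \<Psi>"
    unfolding completely_contractive_on_def
  proof (intro allI impI)
    fix k :: nat and M assume M: "\<forall>i<k. \<forall>j<k. M i j \<in> domain_algebra b"
    \<comment> \<open>An approximating sequence is chosen for each entry. The inequality for
      matrices of polynomials holds at every \<open>n\<close> and passes to the limit on both
      sides.\<close>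
    define p where "p i j = (SOME p. (\<lambda>n::nat. poly_op (p n) (universal_model b)) \<longlonglongrightarrow> M i j \<and>
        (\<lambda>n. poly_op (p n) T) \<longlonglongrightarrow> \<Psi> (M i j))" for i j
    have p: "(\<lambda>n. poly_op (p i j n) (universal_model b)) \<longlonglongrightarrow> M i j \<and> (\<lambda>n. poly_op (p i j n) T) \<longlonglongrightarrow> \<Psi> (M i j)"
      if "i < k" "j < k" for i j
    proof -
      have "calculus_rel (M i j) (\<Psi> (M i j))" using rel M that by simp
      then show ?thesis
        unfolding p_def calculus_rel_def by (rule someI_ex)
    qed
    show "op_matrix_norm k (\<lambda>i j. \<Psi> (M i j)) \<le> op_matrix_norm k M"
    proof (rule op_matrix_norm_limit_le[where M = "\<lambda>n i j. poly_op (p i j n) T"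
          and N = "\<lambda>n i j. poly_op (p i j n) (universal_model b)"])
      show "op_matrix_norm k (\<lambda>i j. poly_op (p i j n) T)
          \<le> op_matrix_norm k (\<lambda>i j. poly_op (p i j n) (universal_model b))" for n
        by (rule op_matrix_norm_poly_op_le[OF adm T])
    qed (rule p[THEN conjunct2] p[THEN conjunct1]; assumption)+
  qed
  moreover have "\<forall>p. \<Psi> (poly_op p (universal_model b)) = poly_op p T"
    by (rule allI) (rule \<Psi>[OF calculus_rel_poly])
  ultimately have "unital_homomorphism_on (domain_algebra b) \<Psi> \<and> completely_contractive_on (domain_algebra b) \<Psi> \<and>
     (\<forall>p. \<Psi> (poly_op p (universal_model b)) = poly_op p T)"
    by (intro conjI)
  then show ?thesis by (rule exI[of _ \<Psi>])
qed

end

theorem corollary1p14: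
  fixes b :: "'n::finite list \<Rightarrow> real"
    and T :: "('h::chilbert_space \<Rightarrow>\<^sub>L 'h) ^ 'n"
  assumes "admissible b"
    and "T \<in> closure (pure_nc_domain b)"
  shows "(\<forall>(m::nat) (d :: 'n list \<Rightarrow> 'n list \<Rightarrow> complex).
            norm (\<Sum>\<alpha> | length \<alpha> \<le> m. \<Sum>\<beta> | length \<beta> \<le> m.
                    d \<alpha> \<beta> *\<^sub>C (word_op T \<alpha> o\<^sub>L adj (word_op T \<beta>)))
            \<le> norm (\<Sum>\<alpha> | length \<alpha> \<le> m. \<Sum>\<beta> | length \<beta> \<le> m.
                    d \<alpha> \<beta> *\<^sub>C (word_op (universal_model b) \<alpha>
                              o\<^sub>L adj (word_op (universal_model b) \<beta>))))
       \<and> (\<exists>\<Psi> :: ('n list ell2 \<Rightarrow>\<^sub>L 'n list ell2) \<Rightarrow> ('h \<Rightarrow>\<^sub>L 'h).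
            unital_homomorphism_on (domain_algebra b) \<Psi> \<and>
            completely_contractive_on (domain_algebra b) \<Psi> \<and>
            (\<forall>p :: 'n list \<Rightarrow>\<^sub>0 complex. \<Psi> (poly_op p (universal_model b)) = poly_op p T))"
proof (intro conjI allI)
  fix m :: nat and d :: "'n list \<Rightarrow> 'n list \<Rightarrow> complex"
  show "norm (\<Sum>\<alpha> | length \<alpha> \<le> m. \<Sum>\<beta> | length \<beta> \<le> m.
                    d \<alpha> \<beta> *\<^sub>C (word_op T \<alpha> o\<^sub>L adj (word_op T \<beta>)))
            \<le> norm (\<Sum>\<alpha> | length \<alpha> \<le> m. \<Sum>\<beta> | length \<beta> \<le> m.
                    d \<alpha> \<beta> *\<^sub>C (word_op (universal_model b) \<alpha>
                              o\<^sub>L adj (word_op (universal_model b) \<beta>)))"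
    \<comment> \<open>The 1 by 1 case, with the words of length at most \<open>m\<close> as the word
      set.\<close>
    using op_matrix_norm_nc_kernel_le[OF assms, of 1 "{\<alpha>. length \<alpha> \<le> m}" "\<lambda>i j. d"]
    by (simp only: op_matrix_norm_1 nc_kernel_def)
qed (rule functional_calculus_exists[OF assms])

end
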